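(* A minimal surface in the Matsumoto space $(V^3,F_b)$ which is the graph of a function defined on $\mathbb{R}^2$ is a plane. That is, if $f:\mathbb{R}^2\to\mathbb{R}$ is smooth and the immersion $\varphi:\mathbb{R}^2\to(V^3,F_b)$, $\varphi(x^1,x^2)=(x^1,x^2,f(x^1,x^2))$, is minimal, then $\varphi(\mathbb{R}^2)$ is a plane.
   Context: Greek indices range over $\{1,2\}$, Latin indices over $\{1,2,3\}$, and repeated indices are summed. $V^3$ is a $3$-dimensional real vector space with linear coordinates $(\tilde x^1,\tilde x^2,\tilde x^3)$, and $F_b=\frac{\tilde\alpha^2}{\tilde\alpha-\tilde\beta}$ is the Minkowski Matsumoto metric on it, where $\tilde\alpha$ is the Euclidean metric, $\tilde\alpha(y)=\sqrt{(y^1)^2+(y^2)^2+(y^3)^2}$, and $\tilde\beta=b\,d\tilde x^3$, i.e. $\tilde\beta(y)=b\,y^3$, with $b$ a constant, $0\le b<1/2$ (and $F_b(0)=0$). "Plane" means a $2$-dimensional affine subspace of $V^3$. For a $3\times 2$ matrix $z=(z^i_\epsilon)$ of rank $2$ put $$\mathcal F(z)=\frac{\mathrm{vol}(B^2)}{\mathrm{vol}(D_z)},\qquad D_z=\{(y^1,y^2)\in\mathbb{R}^2: F_b(y^\epsilon z_\epsilon)<1\},\quad z_\epsilon=(z^1_\epsilon,z^2_\epsilon,z^3_\epsilon),$$ with $B^2$ the Euclidean unit disc and $\mathrm{vol}$ Euclidean area. For an immersion $\varphi$ with $z^i_\epsilon=\partial\varphi^i/\partial x^\epsilon$, the mean curvature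 (with respect to the Busemann-Hausdorff volume) is $$\mathcal H_\varphi(v)=\frac{1}{\mathcal F}\Big\{\frac{\partial^2\mathcal F}{\partial z^i_\epsilon\partial z^j_\eta}\frac{\partial^2\varphi^j}{\partial x^\epsilon\partial x^\eta}\Big\}v^i$$ for vector fields $v=(v^i)$ along $\varphi$; $\varphi$ (or the surface it parametrizes) is called minimal when $\mathcal H_\varphi=0$, i.e. $\mathcal H_\varphi(v)=0$ for all $v$. *)

theory Defs
  imports "HOL-Analysis.Analysis"
begin

(* At y = 0 the quotient is 0 / 0 = 0, so F_b(0) = 0. *)
definition matsumoto :: "real \<Rightarrow> real ^ 3 \<Rightarrow> real" where
  "matsumoto b y = (norm y)\<^sup>2 / (norm y - b * y $ 3)"

(* A 3 x 2 matrix z = (z^i_e) is an element of real ^ 2 ^ 3 with z^i_e = z $ i $ e;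
   its columns are the vectors z_e, and z *v y = y^e z_e. *)
definition D_set :: "real \<Rightarrow> real ^ 2 ^ 3 \<Rightarrow> (real ^ 2) set" where
  "D_set b z = {y. matsumoto b (z *v y) < 1}"

(* Meaningful for z of rank 2 only. These z form an open set, so the partial derivatives
   of BH_F at such z do not depend on the values of BH_F elsewhere. *)
definition BH_F :: "real \<Rightarrow> real ^ 2 ^ 3 \<Rightarrow> real" where
  "BH_F b z = measure lebesgue (ball (0 :: real ^ 2) 1) / measure lebesgue (D_set b z)"

(* Directional derivative at x; for a coordinate vector v it is the partial derivative. *)
definition pd :: "'a::real_vector \<Rightarrow> ('a \<Rightarrow> real) \<Rightarrow> 'a \<Rightarrow> real" where
  "pd v g x = deriv (\<lambda>t. g (x + t *\<^sub>R v)) 0"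

abbreviation pdx :: "2 \<Rightarrow> (real ^ 2 \<Rightarrow> real) \<Rightarrow> real ^ 2 \<Rightarrow> real" where
  "pdx \<epsilon> \<equiv> pd (axis \<epsilon> 1)"

abbreviation pdz :: "3 \<Rightarrow> 2 \<Rightarrow> (real ^ 2 ^ 3 \<Rightarrow> real) \<Rightarrow> real ^ 2 ^ 3 \<Rightarrow> real" where
  "pdz i \<epsilon> \<equiv> pd (axis i (axis \<epsilon> 1))"

definition jac :: "(real ^ 2 \<Rightarrow> real ^ 3) \<Rightarrow> real ^ 2 \<Rightarrow> real ^ 2 ^ 3" where
  "jac \<phi> x = (\<chi> i \<epsilon>. pdx \<epsilon> (\<lambda>u. \<phi> u $ i) x)"

primrec C_k :: "nat \<Rightarrow> ('a::real_normed_vector \<Rightarrow> 'b::real_normed_vector) \<Rightarrow> bool" where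
  "C_k 0 g \<longleftrightarrow> continuous_on UNIV g"
| "C_k (Suc k) g \<longleftrightarrow>
     (\<forall>x. g differentiable (at x)) \<and> (\<forall>v. C_k k (\<lambda>x. frechet_derivative g (at x) v))"

(* C^infinity on the whole (finite-dimensional) space *)
definition smooth :: "('a::euclidean_space \<Rightarrow> 'b::real_normed_vector) \<Rightarrow> bool" where
  "smooth g \<longleftrightarrow> (\<forall>k. C_k k g)"

definition mean_curvature ::
    "real \<Rightarrow> (real ^ 2 \<Rightarrow> real ^ 3) \<Rightarrow> (real ^ 2 \<Rightarrow> real ^ 3) \<Rightarrow> real ^ 2 \<Rightarrow> real" where
  "mean_curvature b \<phi> v x =
     1 / BH_F b (jac \<phi> x) *
     (\<Sum>i\<in>UNIV. (\<Sum>j\<in>UNIV. \<Sum>\<epsilon>\<in>UNIV. \<Sum>\<eta>\<in>UNIV.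
         pdz i \<epsilon> (pdz j \<eta> (BH_F b)) (jac \<phi> x) *
         pdx \<epsilon> (pdx \<eta> (\<lambda>u. \<phi> u $ j)) x) * v x $ i)"

(* Intended for smooth immersions phi only; v ranges over the vector fields along phi. *)
definition minimal :: "real \<Rightarrow> (real ^ 2 \<Rightarrow> real ^ 3) \<Rightarrow> bool" where
  "minimal b \<phi> \<longleftrightarrow> (\<forall>v. smooth v \<longrightarrow> (\<forall>x. mean_curvature b \<phi> v x = 0))"

definition graph_map :: "(real ^ 2 \<Rightarrow> real) \<Rightarrow> real ^ 2 \<Rightarrow> real ^ 3" where
  "graph_map f x = vector [x $ 1, x $ 2, f x]"

definition is_plane :: "(real ^ 3) set \<Rightarrow> bool" where
  "is_plane S \<longleftrightarrow> affine S \<and> aff_dim S = 2"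

end

theory Submission
  imports Defs
begin

text \<open>
  Two facts carry the proof. First, the unit disc of the Matsumoto metric in a plane is bounded by a
  limacon, whose area is elementary; on the graph of \<open>f\<close> with \<open>t = 1 + |grad f|\<^sup>2\<close> the density
  \<open>BH_F\<close> is therefore a constant multiple of \<open>t sqrt t / (t - k)\<close> with \<open>k = b\<^sup>2 / (2 + b\<^sup>2)\<close>
  (\<open>BH_F_graph_frame\<close>). It depends on the gradient only through its length, because the distinguished
  axis of the metric is vertical. For \<open>b < 1 / 2\<close> one has \<open>k < 1 / 9\<close>, and then the Hessian of
  the density in the gradient variables is positive definite and comparable to that of the Euclidean
  area: of size \<open>1 / sqrt t\<close> across the gradient and \<open>1 / (t sqrt t)\<close> along it. Testing
  minimality with the vertical vector field gives the quasilinear elliptic equation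
  \<open>minimal_graph_equation\<close>, which says that the field \<open>K grad f\<close>, for a suitable function
  \<open>K\<close> of the slope, is divergence free.

  Secondly, such an equation has only affine entire solutions. The argument is the stability
  argument with a logarithmic cutoff. Let \<open>p\<close> be the derivative of \<open>f\<close> in the first variable.
  The differentiated equation is tested with \<open>arctan p\<close> times the square of a cutoff which depends
  on the logarithm of the distance in space, not in the plane. As \<open>arctan\<close> is bounded and its derivative
  is \<open>1 / (1 + p\<^sup>2)\<close>, this bounds the weighted quadratic energy of \<open>grad p\<close>
  by the integral over the graph of the square of the gradient of the cutoff, taken with respect to
  Euclidean area (\<open>pointwise_caccioppoli\<close>, \<open>stability_estimate\<close>).
  The area of the graph in large balls grows at most quadratically, like that of a plane, and this
  follows from the divergence-free field because it has length at most one while its product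
  with \<open>grad f\<close> controls the area element; the form used here is the logarithmic bound
  \<open>area_growth\<close>. With a cutoff reaching to distance \<open>exp (N / 2)\<close> the energy is then at most
  a constant over \<open>N\<close>, hence zero. So \<open>grad p = 0\<close>, the equation leaves no room for the
  remaining second derivative, and \<open>f\<close> is affine (\<open>affine_solution\<close>).

  All integrations by parts come from one limit of difference quotients
  (\<open>difference_quotient_integral_limit\<close>). Only second derivatives of \<open>f\<close> occur: the
  differentiated equation is replaced by the identity \<open>integral_jacobian_zero\<close> for a \<open>C\<^sup>1\<close>
  function and a \<open>C\<^sup>1\<close> test function.
\<close>

section \<open>The area enclosed by a limacon\<close>

lemma norm_real2_sq: "(norm (v :: real ^ 2))\<^sup>2 = (v $ 1)\<^sup>2 + (v $ 2)\<^sup>2"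
  by (simp add: norm_vec_def L2_set_def sum_2)

lemma integral_compose_linear_isometry:
  fixes f :: "real ^ 2 \<Rightarrow> real" and g :: "real ^ 2 \<Rightarrow> real ^ 2"
  assumes g: "linear g" and d: "\<bar>det (matrix g)\<bar> = 1" and im: "g ` S = S"
    and f: "f absolutely_integrable_on S"
  shows "integral S (\<lambda>x. f (g x)) = integral S f"
proof -
  let ?F = "\<lambda>x. (vec (f x) :: real ^ 1)"
  have F: "?F absolutely_integrable_on g ` S"
    using f im by (simp add: absolutely_integrable_on_1_iff)
  have "integral (g ` S) ?F = \<bar>det (matrix g)\<bar> *\<^sub>R integral S (?F \<circ> g)"
    by (rule integral_change_of_variables_linear[OF g]) (use F in blast)
  then have e: "integral S ?F = integral S (?F \<circ> g)" using im d by simp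
  have "(?F \<circ> g) absolutely_integrable_on S"
    using absolutely_integrable_on_linear_image[OF g, where f = ?F and S = S] F d by auto
  then have "(?F \<circ> g) integrable_on S"
    by (rule set_lebesgue_integral_eq_integral)
  moreover have "?F integrable_on S" using F unfolding im by (rule set_lebesgue_integral_eq_integral)
  ultimately have "integral S (\<lambda>x. f x) = integral S (\<lambda>x. f (g x))"
    using e by (simp add: integral_on_1_eq comp_def)
  then show ?thesis by simp
qed

abbreviation punctured_disc :: "(real ^ 2) set" where
  "punctured_disc \<equiv> ball 0 1 - {0}"

lemma punctured_disc_lmeasurable: "punctured_disc \<in> lmeasurable"
  by (intro fmeasurable_Diff lmeasurable_ball) auto

lemma measure_punctured_disc: "measure lebesgue punctured_disc = pi"
proof -
  have "measure lebesgue punctured_disc = measure lebesgue (ball (0 :: real ^ 2) 1)"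
    by (rule measure_negligible_symdiff) (auto intro: negligible_subset[of "{0}"])
  then show ?thesis using circle_area[of 1 "0 :: real ^ 2"] by (simp add: content_eq_0)
qed

lemma coordinate_le_norm2: "\<bar>v $ i\<bar> \<le> norm (v :: real ^ 2)"
  by (rule component_le_norm_cart)

lemma direction_cosine_product_integrable:
  "(\<lambda>v. (v $ i / norm v) ^ n :: real) absolutely_integrable_on punctured_disc"
proof (rule measurable_bounded_by_integrable_imp_absolutely_integrable)
  show "(\<lambda>v. (v $ i / norm v) ^ n) \<in> borel_measurable (lebesgue_on punctured_disc)"
    by (rule continuous_imp_measurable_on_sets_lebesgue)
       (auto intro!: continuous_intros punctured_disc_lmeasurable)
  show "(\<lambda>v. 1 :: real) integrable_on punctured_disc"
    using punctured_disc_lmeasurable integrable_on_const by blast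
  show "norm ((v $ i / norm v) ^ n) \<le> 1" if "v \<in> punctured_disc" for v
    using that coordinate_le_norm2[of v i]
    by (auto simp: power_abs abs_divide divide_le_eq_1 intro!: power_le_one)
qed (use punctured_disc_lmeasurable in auto)

text \<open>
  The disc is invariant under \<open>v \<mapsto> - v\<close>, which reverses the sign of the integrand.
\<close>

lemma integral_direction_cosine: "integral punctured_disc (\<lambda>v. v $ 1 / norm v) = 0"
proof -
  have l: "linear (uminus :: real ^ 2 \<Rightarrow> real ^ 2)" by (simp add: linear_iff)
  have "\<bar>det (matrix (uminus :: real ^ 2 \<Rightarrow> real ^ 2))\<bar> = 1"
    by (simp add: det_2 matrix_def axis_def)
  moreover have "uminus ` punctured_disc = punctured_disc"
  proof
    show "uminus ` punctured_disc \<subseteq> punctured_disc" by auto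
    show "punctured_disc \<subseteq> uminus ` punctured_disc"
    proof
      fix v :: "real ^ 2" assume "v \<in> punctured_disc"
      then have "- v \<in> punctured_disc" by auto
      then show "v \<in> uminus ` punctured_disc" by (metis minus_minus image_eqI)
    qed
  qed
  ultimately have "integral punctured_disc (\<lambda>v. (- v) $ 1 / norm (- v)) = integral punctured_disc (\<lambda>v. v $ 1 / norm v)"
    using direction_cosine_product_integrable[of 1 1]
    by (intro integral_compose_linear_isometry[OF l]) auto
  then show ?thesis by simp
qed

text \<open>
  Exchanging the coordinates exchanges the squares of the two direction cosines, and these add up to
  one; so each of them integrates to half the area. This replaces polar coordinates.
\<close>

lemma integral_direction_cosine_sq: "integral punctured_disc (\<lambda>v. (v $ 1 / norm v)\<^sup>2) = pi / 2"
proof -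
  let ?s = "(\<lambda>v. vector [v $ 2, v $ 1]) :: real ^ 2 \<Rightarrow> real ^ 2"
  have l: "linear ?s" by (simp add: linear_iff vec_eq_iff forall_2)
  have n: "norm (?s v) = norm v" for v
    by (simp add: norm_vec_def L2_set_def sum_2 add.commute)
  have z: "?s v = 0 \<longleftrightarrow> v = 0" for v by (metis n norm_eq_zero)
  have i: "?s (?s v) = v" for v by (simp add: vec_eq_iff forall_2)
  have "\<bar>det (matrix ?s)\<bar> = 1" by (simp add: det_2 matrix_def axis_def)
  moreover have "?s ` punctured_disc = punctured_disc"
  proof
    show "?s ` punctured_disc \<subseteq> punctured_disc" using n z by auto
    show "punctured_disc \<subseteq> ?s ` punctured_disc"
    proof
      fix v assume "v \<in> punctured_disc"
      then have "?s v \<in> punctured_disc" using n z by auto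
      then have "?s (?s v) \<in> ?s ` punctured_disc" by (rule imageI)
      then show "v \<in> ?s ` punctured_disc" unfolding i .
    qed
  qed
  ultimately have e: "integral punctured_disc (\<lambda>v. (?s v $ 1 / norm (?s v))\<^sup>2) = integral punctured_disc (\<lambda>v. (v $ 1 / norm v)\<^sup>2)"
    by (intro integral_compose_linear_isometry[OF l]) (auto intro: direction_cosine_product_integrable)
  have int: "(\<lambda>v. (v $ i / norm v)\<^sup>2) integrable_on punctured_disc" for i :: 2
    using direction_cosine_product_integrable[of i 2] set_lebesgue_integral_eq_integral(1) by blast
  have "integral punctured_disc (\<lambda>v. (v $ 2 / norm v)\<^sup>2) + integral punctured_disc (\<lambda>v. (v $ 1 / norm v)\<^sup>2)
     = integral punctured_disc (\<lambda>v. (v $ 2 / norm v)\<^sup>2 + (v $ 1 / norm v)\<^sup>2)"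
    by (rule integral_add[symmetric]) (rule int)+
  also have "\<dots> = integral punctured_disc (\<lambda>v. 1)"
  proof (rule integral_cong)
    fix v assume "v \<in> punctured_disc"
    then have "v \<noteq> 0" by auto
    then show "(v $ 2 / norm v)\<^sup>2 + (v $ 1 / norm v)\<^sup>2 = 1"
      unfolding power_divide add_divide_distrib[symmetric]
      using norm_real2_sq[of v] by (metis add.commute divide_self norm_eq_zero power_not_zero)
  qed
  also have "\<dots> = pi"
    using punctured_disc_lmeasurable measure_punctured_disc lmeasure_integral by metis
  finally show ?thesis using e n by simp
qed

text \<open>
  In polar coordinates \<open>0 < r < 1 - \<epsilon> cos \<phi>\<close>. The origin is left out, so that the radial
  map onto this set is differentiable on all of its domain.
\<close>

definition limacon :: "real \<Rightarrow> (real ^ 2) set" where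
  "limacon \<epsilon> = {v. v \<noteq> 0 \<and> (norm v)\<^sup>2 < norm v - \<epsilon> * v $ 1}"

lemma limacon_factor_pos:
  assumes "\<bar>\<epsilon>\<bar> < 1" shows "0 < 1 - \<epsilon> * (v $ 1 / norm (v :: real ^ 2))"
proof -
  have "\<bar>v $ 1 / norm v\<bar> \<le> 1" using coordinate_le_norm2[of v 1]
    by (cases "v = 0") (auto simp: abs_divide)
  then have "\<bar>\<epsilon> * (v $ 1 / norm v)\<bar> \<le> \<bar>\<epsilon>\<bar>" by (metis abs_ge_zero abs_mult mult.right_neutral mult_left_mono)
  then show ?thesis using assms by linarith
qed

text \<open>
  The radial stretching \<open>v \<mapsto> (1 - \<epsilon> v\<^sub>1 / |v|) v\<close> maps the punctured disc bijectively
  onto the limacon. Its derivative is \<open>a\<close> times the identity plus the rank-one map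
  \<open>h \<mapsto> g(h) v\<close>, where \<open>a\<close> is the stretching factor and \<open>g\<close> its differential. The factor is
  constant on rays, so \<open>g(v) = 0\<close> and the Jacobian determinant is \<open>a\<^sup>2\<close>, a quadratic
  polynomial in the first direction cosine.
\<close>

lemma limacon_area:
  assumes e: "\<bar>\<epsilon>\<bar> < 1"
  shows "limacon \<epsilon> \<in> lmeasurable" "measure lebesgue (limacon \<epsilon>) = pi * (1 + \<epsilon>\<^sup>2 / 2)"
proof -
  define c where "c = (\<lambda>v :: real ^ 2. v $ 1 / norm v)"
  define a where "a = (\<lambda>v. 1 - \<epsilon> * c v)"
  define \<Phi> where "\<Phi> = (\<lambda>v. a v *\<^sub>R v)"
  have a_pos: "0 < a v" for v using limacon_factor_pos[OF e] by (simp add: a_def c_def)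
  have c_scale: "c (t *\<^sub>R v) = c v" if "t > 0" for t v
    using that by (simp add: c_def)
  have a_scale: "a (t *\<^sub>R v) = a v" if "t > 0" for t v
    using that by (simp add: a_def c_scale)
  have lim: "limacon \<epsilon> = {w. w \<noteq> 0 \<and> norm w < a w}"
  proof -
    have "(norm w)\<^sup>2 < norm w - \<epsilon> * w $ 1 \<longleftrightarrow> norm w < a w" if "w \<noteq> 0" for w :: "real ^ 2"
    proof -
      have "norm w - \<epsilon> * w $ 1 = norm w * a w" using that by (simp add: a_def c_def field_simps)
      then show ?thesis using that by (simp add: power2_eq_square)
    qed
    then show ?thesis by (auto simp: limacon_def)
  qed
  have image: "\<Phi> ` punctured_disc = limacon \<epsilon>"
  proof
    show "\<Phi> ` punctured_disc \<subseteq> limacon \<epsilon>"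
    proof
      fix w assume "w \<in> \<Phi> ` punctured_disc"
      then obtain v where "v \<in> punctured_disc" and w: "w = a v *\<^sub>R v" unfolding \<Phi>_def by blast
      then have v: "v \<noteq> 0" "norm v < 1" "w = a v *\<^sub>R v" by auto
      then show "w \<in> limacon \<epsilon>" using a_pos[of v] by (simp add: lim a_scale)
    qed
    show "limacon \<epsilon> \<subseteq> \<Phi> ` punctured_disc"
    proof
      fix w assume "w \<in> limacon \<epsilon>"
      then have w: "w \<noteq> 0" "norm w < a w" by (auto simp: lim)
      define v where "v = (1 / a w) *\<^sub>R w"
      have "\<Phi> v = w" using a_pos[of w] by (simp add: v_def \<Phi>_def a_scale)
      moreover have "v \<in> punctured_disc" using w a_pos[of w] by (simp add: v_def)
      ultimately show "w \<in> \<Phi> ` punctured_disc" by blast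
    qed
  qed
  have inj: "inj_on \<Phi> punctured_disc"
  proof (rule inj_onI)
    fix v w assume h: "\<Phi> v = \<Phi> w"
    have "a (\<Phi> v) = a v" "a (\<Phi> w) = a w" using a_pos by (simp_all add: \<Phi>_def a_scale)
    then have "a v = a w" using h by metis
    moreover have "a v *\<^sub>R v = a w *\<^sub>R w" using h unfolding \<Phi>_def .
    ultimately have "a w *\<^sub>R v = a w *\<^sub>R w" by metis
    then show "v = w" using a_pos[of w] by (metis less_irrefl scaleR_left_imp_eq)
  qed
  define g where "g = (\<lambda>v h :: real ^ 2. - \<epsilon> * (h $ 1 / norm v - v $ 1 * (v \<bullet> h) / norm v ^ 3))"
  define \<Phi>' where "\<Phi>' = (\<lambda>v h. a v *\<^sub>R h + g v h *\<^sub>R v)"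
  have deriv: "(\<Phi> has_derivative \<Phi>' v) (at v within punctured_disc)" if "v \<in> punctured_disc" for v
  proof -
    have v: "v \<noteq> 0" using that by auto
    have coord: "((\<lambda>x :: real ^ 2. x $ 1) has_derivative (\<lambda>h. h $ 1)) (at v)"
      by (rule bounded_linear_imp_has_derivative) (rule bounded_linear_vec_nth)
    have "(norm has_derivative (\<lambda>h. (v \<bullet> h) / norm v)) (at v)"
      using has_derivative_norm[OF v] by (simp add: sgn_div_norm inner_commute divide_inverse mult.commute)
    then have "((\<lambda>x. x $ 1 / norm x) has_derivative
        (\<lambda>h. (h $ 1 * norm v - v $ 1 * ((v \<bullet> h) / norm v)) / (norm v * norm v))) (at v)"
      using v by (intro has_derivative_divide'[OF coord]) auto
    moreover have "(h $ 1 * norm v - v $ 1 * ((v \<bullet> h) / norm v)) / (norm v * norm v)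
        = h $ 1 / norm v - v $ 1 * (v \<bullet> h) / norm v ^ 3" for h
      using v by (simp add: field_simps power3_eq_cube)
    ultimately have "(c has_derivative (\<lambda>h. h $ 1 / norm v - v $ 1 * (v \<bullet> h) / norm v ^ 3)) (at v)"
      by (simp add: c_def)
    then have "(a has_derivative g v) (at v)"
      unfolding a_def g_def
      using has_derivative_diff[OF has_derivative_const has_derivative_mult_right]
      by (fastforce simp: algebra_simps)
    then have "(\<Phi> has_derivative \<Phi>' v) (at v)"
      unfolding \<Phi>_def \<Phi>'_def by (rule has_derivative_scaleR[OF _ has_derivative_ident])
    then show ?thesis by (rule has_derivative_at_withinI)
  qed
  have det: "\<bar>det (matrix (\<Phi>' v))\<bar> = (1 - \<epsilon> * (v $ 1 / norm v))\<^sup>2" if "v \<in> punctured_disc" for v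
  proof -
    have v: "v \<noteq> 0" using that by auto
    have "v $ 1 * g v (axis 1 1) + v $ 2 * g v (axis 2 1)
      = - \<epsilon> * (v $ 1 / norm v - v $ 1 * ((v $ 1)\<^sup>2 + (v $ 2)\<^sup>2) / norm v ^ 3)"
      by (simp add: g_def inner_axis algebra_simps power2_eq_square add_divide_distrib, simp add: axis_def)
    also have "\<dots> = 0" using v unfolding norm_real2_sq[symmetric] by (simp add: power2_eq_square power3_eq_cube)
    \<comment> \<open>The stretching factor does not change along rays.\<close>
    finally have z: "v $ 1 * g v (axis 1 1) + v $ 2 * g v (axis 2 1) = 0" .
    have "det (matrix (\<Phi>' v)) = (a v)\<^sup>2 + a v * (v $ 1 * g v (axis 1 1) + v $ 2 * g v (axis 2 1))"
      unfolding det_2 matrix_def by (simp add: \<Phi>'_def axis_def algebra_simps power2_eq_square)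
    then show ?thesis unfolding z by (simp add: a_def c_def)
  qed
  have c1: "c integrable_on punctured_disc" and c2: "(\<lambda>v. (c v)\<^sup>2) integrable_on punctured_disc"
    and c0: "(\<lambda>v. 1 :: real) integrable_on punctured_disc"
    using direction_cosine_product_integrable[of 1 1] direction_cosine_product_integrable[of 1 2]
      set_lebesgue_integral_eq_integral(1) punctured_disc_lmeasurable integrable_on_const
    unfolding c_def by (fastforce, fastforce, blast)
  have "((\<lambda>v. 1 + (- (2 * \<epsilon>) * c v + \<epsilon>\<^sup>2 * (c v)\<^sup>2)) has_integral (pi + (- (2 * \<epsilon>) * 0 + \<epsilon>\<^sup>2 * (pi / 2)))) punctured_disc"
  proof (intro has_integral_add has_integral_mult_right)
    show "((\<lambda>v. 1) has_integral pi) punctured_disc"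
      using integrable_integral[OF c0] lmeasure_integral[OF punctured_disc_lmeasurable] measure_punctured_disc by simp
    show "(c has_integral 0) punctured_disc"
      using integrable_integral[OF c1] integral_direction_cosine by (simp add: c_def)
    show "((\<lambda>v. (c v)\<^sup>2) has_integral pi / 2) punctured_disc"
      using integrable_integral[OF c2] integral_direction_cosine_sq by (simp add: c_def)
  qed
  then have "((\<lambda>v. \<bar>det (matrix (\<Phi>' v))\<bar>) has_integral pi * (1 + \<epsilon>\<^sup>2 / 2)) punctured_disc"
    by (subst has_integral_cong[OF det])
       (auto simp: c_def power2_diff power_mult_distrib power_divide algebra_simps)
  then have "\<Phi> ` punctured_disc \<in> lmeasurable \<and> measure lebesgue (\<Phi> ` punctured_disc) = pi * (1 + \<epsilon>\<^sup>2 / 2)"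
    using has_measure_differentiable_image[OF _ deriv inj] punctured_disc_lmeasurable by blast
  then show "limacon \<epsilon> \<in> lmeasurable" "measure lebesgue (limacon \<epsilon>) = pi * (1 + \<epsilon>\<^sup>2 / 2)"
    by (simp_all add: image)
qed

section \<open>The Busemann-Hausdorff density of a graph\<close>

lemma norm_real3_sq: "(norm (v :: real ^ 3))\<^sup>2 = (v $ 1)\<^sup>2 + (v $ 2)\<^sup>2 + (v $ 3)\<^sup>2"
  by (simp add: norm_vec_def L2_set_def sum_3)

text \<open>
  The Jacobian matrix of a graph whose slopes are \<open>p\<close> and \<open>q\<close>.
\<close>

definition graph_frame :: "real \<Rightarrow> real \<Rightarrow> real ^ 2 ^ 3" where
  "graph_frame p q = vector [vector [1, 0], vector [0, 1], vector [p, q]]"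

lemma graph_frame_mult: "graph_frame p q *v y = vector [y $ 1, y $ 2, p * y $ 1 + q * y $ 2]"
  by (simp add: graph_frame_def matrix_vector_mult_def vec_eq_iff forall_3 sum_2)

lemma polar_slope: obtains s e1 e2 :: real where "e1\<^sup>2 + e2\<^sup>2 = 1" "p = s * e1" "q = s * e2"
proof (cases "p = 0 \<and> q = 0")
  case True
  then show ?thesis using that[of 1 0 0] by simp
next
  case False
  define s where "s = sqrt (p\<^sup>2 + q\<^sup>2)"
  have s2: "s\<^sup>2 = p\<^sup>2 + q\<^sup>2" by (simp add: s_def)
  have "s \<noteq> 0" using False by (simp add: s_def sum_power2_eq_zero_iff)
  then have "(p / s)\<^sup>2 + (q / s)\<^sup>2 = 1"
    unfolding power_divide add_divide_distrib[symmetric] s2[symmetric] by simp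
  then show ?thesis using that[of "p / s" "q / s" s] \<open>s \<noteq> 0\<close> by simp
qed

text \<open>
  The denominator of the metric is positive off the origin, so the inequality may be cleared of it.
  The origin satisfies it because the quotient is zero there.
\<close>

lemma matsumoto_less_1_iff:
  assumes "\<bar>b\<bar> < 1"
  shows "matsumoto b y < 1 \<longleftrightarrow> y = 0 \<or> (norm y)\<^sup>2 < norm y - b * y $ 3"
proof (cases "y = 0")
  case False
  have "\<bar>b * y $ 3\<bar> \<le> \<bar>b\<bar> * norm y"
    unfolding abs_mult by (intro mult_left_mono component_le_norm_cart) auto
  also have "\<dots> < 1 * norm y" using assms False by (intro mult_strict_right_mono) auto
  finally have "0 < norm y - b * y $ 3" by linarith
  then show ?thesis using False by (simp add: matsumoto_def divide_less_eq_1)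
qed (simp add: matsumoto_def)

text \<open>
  The density of a graph up to a constant factor, as a function of \<open>t = 1 + p\<^sup>2 + q\<^sup>2\<close>, the
  square of the Euclidean area element; \<open>k = 0\<close> is the Euclidean case.
\<close>

definition busemann_density :: "real \<Rightarrow> real \<Rightarrow> real" where
  "busemann_density k t = t * sqrt t / (t - k)"

text \<open>
  Let \<open>s\<close> be the length of the slope vector and \<open>W = sqrt (1 + s\<^sup>2)\<close>. The linear map \<open>T\<close>
  below turns the first coordinate axis into the direction of steepest ascent and makes the composition
  with the graph frame an isometry onto the tangent plane. The height there is \<open>s / W\<close> times the
  first coordinate. Hence the unit disc is the image of the limacon with parameter \<open>\<epsilon> = b s / W\<close>, and
  its area is that of the limacon divided by \<open>W\<close>.
\<close>

lemma BH_F_graph_frame: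
  assumes b: "\<bar>b\<bar> < 1"
  shows "BH_F b (graph_frame p q) = 2 / (2 + b\<^sup>2) * busemann_density (b\<^sup>2 / (2 + b\<^sup>2)) (1 + p\<^sup>2 + q\<^sup>2)"
proof -
  obtain s e1 e2 where e: "e1\<^sup>2 + e2\<^sup>2 = 1" and p: "p = s * e1" and q: "q = s * e2"
    by (rule polar_slope)
  define W where "W = sqrt (1 + s\<^sup>2)"
  have W: "W > 0" "W\<^sup>2 = 1 + s\<^sup>2" by (auto simp: W_def add_pos_nonneg)
  define \<epsilon> where "\<epsilon> = b * s / W"
  have "\<bar>s\<bar> \<le> W" by (simp add: W_def real_le_rsqrt)
  then have "\<bar>s\<bar> / W \<le> 1" using W by simp
  then have "\<bar>b\<bar> * (\<bar>s\<bar> / W) \<le> \<bar>b\<bar> * 1" by (intro mult_left_mono) auto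
  moreover have "\<bar>\<epsilon>\<bar> = \<bar>b\<bar> * (\<bar>s\<bar> / W)" using W by (simp add: \<epsilon>_def abs_mult)
  ultimately have \<epsilon>1: "\<bar>\<epsilon>\<bar> < 1" using b by linarith
  define T where "T = (\<lambda>v :: real ^ 2. vector [v $ 1 / W * e1 - v $ 2 * e2, v $ 1 / W * e2 + v $ 2 * e1] :: real ^ 2)"
  have T1: "T v $ 1 = v $ 1 * (e1 / W) - v $ 2 * e2" and T2: "T v $ 2 = v $ 1 * (e2 / W) + v $ 2 * e1" for v
    by (simp_all add: T_def)
  have T: "linear T"
    by (rule linearI) (simp_all add: vec_eq_iff forall_2 T1 T2 ring_distribs add_divide_distrib)
  have T_surj: "T (vector [W * (y $ 1 * e1 + y $ 2 * e2), y $ 2 * e1 - y $ 1 * e2]) = y" for y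
  proof -
    let ?v = "vector [W * (y $ 1 * e1 + y $ 2 * e2), y $ 2 * e1 - y $ 1 * e2] :: real ^ 2"
    have "T ?v $ 1 = (y $ 1 * e1 + y $ 2 * e2) * e1 - (y $ 2 * e1 - y $ 1 * e2) * e2"
      "T ?v $ 2 = (y $ 1 * e1 + y $ 2 * e2) * e2 + (y $ 2 * e1 - y $ 1 * e2) * e1"
      using W(1) by (simp_all add: T1 T2)
    moreover have "(y $ 1 * e1 + y $ 2 * e2) * e1 - (y $ 2 * e1 - y $ 1 * e2) * e2 = y $ 1 * (e1\<^sup>2 + e2\<^sup>2)"
      "(y $ 1 * e1 + y $ 2 * e2) * e2 + (y $ 2 * e1 - y $ 1 * e2) * e1 = y $ 2 * (e1\<^sup>2 + e2\<^sup>2)"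
      by (simp_all add: power2_eq_square algebra_simps)
    ultimately show ?thesis unfolding vec_eq_iff forall_2 e by simp
  qed
  have det: "det (matrix T) = 1 / W"
  proof -
    have "det (matrix T) = (e1\<^sup>2 + e2\<^sup>2) / W"
      unfolding det_2 matrix_def
      by (simp add: T1 T2 axis_def power2_eq_square add_divide_distrib del: vector_2)
    then show ?thesis by (simp add: e)
  qed
  have height: "(graph_frame p q *v T v) $ 3 = s / W * v $ 1" for v
  proof -
    have "(graph_frame p q *v T v) $ 3 = p * T v $ 1 + q * T v $ 2" by (simp add: graph_frame_mult)
    also have "\<dots> = s * (v $ 1 / W) * (e1\<^sup>2 + e2\<^sup>2)"
      unfolding T1 T2 p q by (simp add: power2_eq_square algebra_simps add_divide_distrib)
    also have "\<dots> = s / W * v $ 1" unfolding e by simp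
    finally show ?thesis .
  qed
  have isometry: "norm (graph_frame p q *v T v) = norm v" for v
  proof -
    have "(T v $ 1)\<^sup>2 + (T v $ 2)\<^sup>2 = ((v $ 1 / W)\<^sup>2 + (v $ 2)\<^sup>2) * (e1\<^sup>2 + e2\<^sup>2)"
      unfolding T1 T2 by (simp add: power2_eq_square algebra_simps add_divide_distrib)
    moreover have "(v $ 1 / W)\<^sup>2 + (s / W * v $ 1)\<^sup>2 = (v $ 1)\<^sup>2"
    proof -
      have "(v $ 1 / W)\<^sup>2 + (s / W * v $ 1)\<^sup>2 = (v $ 1)\<^sup>2 * ((1 + s\<^sup>2) / W\<^sup>2)"
        by (simp add: power_divide power_mult_distrib add_divide_distrib algebra_simps)
      also have "(1 + s\<^sup>2) / W\<^sup>2 = 1" using W by (metis divide_self less_irrefl power_not_zero)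
      finally show ?thesis by simp
    qed
    moreover have "(norm (graph_frame p q *v T v))\<^sup>2 = (T v $ 1)\<^sup>2 + (T v $ 2)\<^sup>2 + (s / W * v $ 1)\<^sup>2"
      unfolding norm_real3_sq height by (simp add: graph_frame_mult)
    ultimately have "(norm (graph_frame p q *v T v))\<^sup>2 = (norm v)\<^sup>2"
      using W e by (simp add: norm_real2_sq)
    then show ?thesis by simp
  qed
  have zero: "graph_frame p q *v T v = 0 \<longleftrightarrow> v = 0" for v
    using isometry[of v] by (metis norm_eq_zero)
  have inD: "T v \<in> D_set b (graph_frame p q) \<longleftrightarrow> v \<in> insert 0 (limacon \<epsilon>)" for v
    unfolding D_set_def mem_Collect_eq matsumoto_less_1_iff[OF b] zero isometry height
    by (auto simp: limacon_def \<epsilon>_def)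
  have D: "D_set b (graph_frame p q) = T ` insert 0 (limacon \<epsilon>)"
  proof (intro set_eqI iffI)
    fix y assume y: "y \<in> D_set b (graph_frame p q)"
    show "y \<in> T ` insert 0 (limacon \<epsilon>)"
      using y T_surj[of y] inD by (metis imageI)
  qed (use inD in auto)
  have "negligible (limacon \<epsilon> - insert 0 (limacon \<epsilon>) \<union> (insert 0 (limacon \<epsilon>) - limacon \<epsilon>))"
    by (rule negligible_subset[OF negligible_sing[of 0]]) auto
  then have m: "insert 0 (limacon \<epsilon>) \<in> lmeasurable" "measure lebesgue (insert 0 (limacon \<epsilon>)) = pi * (1 + \<epsilon>\<^sup>2 / 2)"
    using lmeasurable_negligible_symdiff[OF limacon_area(1)[OF \<epsilon>1]]
      measure_negligible_symdiff[OF limacon_area(1)[OF \<epsilon>1]] limacon_area(2)[OF \<epsilon>1]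
    by metis+
  have "measure lebesgue (D_set b (graph_frame p q)) = 1 / W * (pi * (1 + \<epsilon>\<^sup>2 / 2))"
    unfolding D using measure_linear_image[OF T m(1)] W by (simp add: det m(2))
  moreover have "measure lebesgue (ball (0 :: real ^ 2) 1) = pi"
    using circle_area[of 1 "0 :: real ^ 2"] by (simp add: content_eq_0)
  ultimately have B: "BH_F b (graph_frame p q) = W / (1 + \<epsilon>\<^sup>2 / 2)"
    by (simp add: BH_F_def)
  have t: "1 + p\<^sup>2 + q\<^sup>2 = W\<^sup>2"
  proof -
    have "p\<^sup>2 + q\<^sup>2 = s\<^sup>2 * (e1\<^sup>2 + e2\<^sup>2)" by (simp add: p q power_mult_distrib algebra_simps)
    then show ?thesis using e W by simp
  qed
  have \<epsilon>2: "\<epsilon>\<^sup>2 = b\<^sup>2 * (W\<^sup>2 - 1) / W\<^sup>2" using W by (simp add: \<epsilon>_def power_divide power_mult_distrib)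
  have pos: "(2 + b\<^sup>2) * W\<^sup>2 - b\<^sup>2 > 0"
  proof -
    have "b\<^sup>2 * W\<^sup>2 \<ge> b\<^sup>2 * 1" using W by (intro mult_left_mono) auto
    moreover have "W\<^sup>2 > 0" using W(1) by simp
    ultimately show ?thesis unfolding ring_distribs by linarith
  qed
  have "1 + \<epsilon>\<^sup>2 / 2 = ((2 + b\<^sup>2) * W\<^sup>2 - b\<^sup>2) / (2 * W\<^sup>2)"
    unfolding \<epsilon>2 using W(1) by (simp add: field_simps)
  then have "BH_F b (graph_frame p q) = 2 * W\<^sup>2 * W / ((2 + b\<^sup>2) * W\<^sup>2 - b\<^sup>2)"
    unfolding B by simp
  moreover have "2 / (2 + b\<^sup>2) * busemann_density (b\<^sup>2 / (2 + b\<^sup>2)) (W\<^sup>2) = 2 * W\<^sup>2 * W / ((2 + b\<^sup>2) * W\<^sup>2 - b\<^sup>2)"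
  proof -
    have c: "2 + b\<^sup>2 > 0" by (simp add: add_pos_nonneg)
    have "W\<^sup>2 - b\<^sup>2 / (2 + b\<^sup>2) = ((2 + b\<^sup>2) * W\<^sup>2 - b\<^sup>2) / (2 + b\<^sup>2)"
      using c by (simp add: field_simps)
    then show ?thesis using W(1) c by (simp add: busemann_density_def)
  qed
  ultimately show ?thesis by (simp add: t)
qed

section \<open>The minimal surface equation of a graph\<close>

text \<open>
  With \<open>t = 1 + p\<^sup>2 + q\<^sup>2\<close> and \<open>L(p, q) = busemann_density k t\<close>, one has
  \<open>grad L = kappa (p, q)\<close>, and the Hessian of \<open>L\<close> is \<open>kappa\<close> times the identity plus
  \<open>mu\<close> times the matrix \<open>(p, q) (p, q)\<^sup>T\<close>. So \<open>kappa\<close> and \<open>mu\<close> are twice the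
  first derivatives in \<open>t\<close> of \<open>busemann_density\<close> and of \<open>kappa\<close>.
\<close>

definition kappa :: "real \<Rightarrow> real \<Rightarrow> real" where
  "kappa k t = sqrt t * (t - 3 * k) / (t - k)\<^sup>2"

definition mu :: "real \<Rightarrow> real \<Rightarrow> real" where
  "mu k t = - ((t\<^sup>2 - 6 * k * t - 3 * k\<^sup>2) / (sqrt t * (t - k) ^ 3))"

lemma busemann_density_has_derivative:
  assumes "t > 0" "t \<noteq> k"
  shows "(busemann_density k has_real_derivative kappa k t / 2) (at t)"
proof -
  have r: "sqrt t > 0" "sqrt t * sqrt t = t" using assms by auto
  have "(busemann_density k has_real_derivative
      ((1 * sqrt t + inverse (sqrt t) / 2 * t) * (t - k) - t * sqrt t * (1 - 0)) / ((t - k) * (t - k))) (at t)"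
    unfolding busemann_density_def using assms
    by (intro DERIV_divide DERIV_mult DERIV_ident DERIV_real_sqrt DERIV_diff DERIV_const) auto
  moreover have "(1 * sqrt t + inverse (sqrt t) / 2 * t) * (t - k) - t * sqrt t * (1 - 0) = sqrt t * (t - 3 * k) / 2"
  proof -
    have h: "inverse (sqrt t) / 2 * t = sqrt t / 2" using r by (simp add: field_simps)
    show ?thesis unfolding h by (simp add: field_simps)
  qed
  ultimately have "(busemann_density k has_real_derivative sqrt t * (t - 3 * k) / 2 / ((t - k) * (t - k))) (at t)"
    by (simp only:)
  then show ?thesis by (simp add: kappa_def power2_eq_square ac_simps)
qed

lemma kappa_has_derivative:
  assumes "t > 0" "t \<noteq> k"
  shows "(kappa k has_real_derivative mu k t / 2) (at t)"
proof -
  define r where "r = sqrt t"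
  have r: "r > 0" "t = r * r" using assms by (auto simp: r_def)
  have nz: "r * r - k \<noteq> 0" using assms r by auto
  have "(kappa k has_real_derivative
      ((inverse (sqrt t) / 2 * (t - 3 * k) + (1 - 0) * sqrt t) * (t - k)\<^sup>2
        - sqrt t * (t - 3 * k) * (real 2 * ((1 - 0) * (t - k) ^ (2 - Suc 0)))) / ((t - k)\<^sup>2 * (t - k)\<^sup>2)) (at t)"
    unfolding kappa_def using assms
    by (intro DERIV_divide DERIV_mult DERIV_ident DERIV_real_sqrt DERIV_diff DERIV_const DERIV_power) auto
  moreover have "((inverse r / 2 * (t - 3 * k) + (1 - 0) * r) * (t - k)\<^sup>2
        - r * (t - 3 * k) * (real 2 * ((1 - 0) * (t - k) ^ (2 - Suc 0)))) / ((t - k)\<^sup>2 * (t - k)\<^sup>2)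
      = - ((t\<^sup>2 - 6 * k * t - 3 * k\<^sup>2) / (r * (t - k) ^ 3)) / 2"
  proof -
    define d where "d = t - k"
    have d: "d \<noteq> 0" using assms by (simp add: d_def)
    have t: "t = d + k" by (simp add: d_def)
    have "((inverse r / 2 * (t - 3 * k) + r) * d\<^sup>2 - r * (t - 3 * k) * (2 * d)) / (d\<^sup>2 * d\<^sup>2)
      = ((t - 3 * k) + 2 * (r * r)) * d / (2 * r * d ^ 3) - (r * r) * (t - 3 * k) * 4 / (2 * r * d ^ 3)"
      using d r(1) by (simp add: divide_simps power2_eq_square power3_eq_cube) (simp add: algebra_simps)
    also have "\<dots> = - ((t\<^sup>2 - 6 * k * t - 3 * k\<^sup>2) / (r * d ^ 3)) / 2"
      unfolding r(2)[symmetric] using d r(1)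
      by (simp add: divide_simps) (simp add: t power2_eq_square algebra_simps)
    finally show ?thesis by (simp add: d_def)
  qed
  ultimately show ?thesis by (simp add: mu_def r_def)
qed

lemma pd_eq_if:
  assumes "((\<lambda>t. g (x + t *\<^sub>R v)) has_real_derivative d) (at 0)"
  shows "pd v g x = d"
  unfolding pd_def by (rule DERIV_imp_deriv[OF assms])

lemma graph_frame_add:
  "graph_frame p q + t *\<^sub>R axis 3 (axis 1 1) = graph_frame (p + t) q"
  "graph_frame p q + t *\<^sub>R axis 3 (axis 2 1) = graph_frame p (q + t)"
  by (simp_all add: graph_frame_def vec_eq_iff forall_3 forall_2 axis_def)

text \<open>
  The first two components of a graph are linear, so their second derivatives drop out of the mean
  curvature.
\<close>

lemma pd_linear_coordinate: "pdx \<epsilon> (\<lambda>u. u $ i) = (\<lambda>x. if \<epsilon> = i then 1 else 0)"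
  by (rule ext, rule pd_eq_if) (auto intro!: derivative_eq_intros simp: axis_def)

lemma pd_const: "pd v (\<lambda>u. d) x = 0"
  by (rule pd_eq_if) simp

lemma graph_map_component:
  "graph_map f u $ 1 = u $ 1" "graph_map f u $ 2 = u $ 2" "graph_map f u $ 3 = f u"
  by (simp_all add: graph_map_def)

lemma jac_graph_map: "jac (graph_map f) x = graph_frame (pdx 1 f x) (pdx 2 f x)"
  by (simp add: jac_def graph_frame_def vec_eq_iff forall_3 forall_2 graph_map_component pd_linear_coordinate)

lemma smooth_const: "smooth (\<lambda>x. d)"
proof -
  have "C_k n (\<lambda>x :: 'a. d :: 'b)" for n and d :: 'b
    by (induction n arbitrary: d) (auto simp: frechet_derivative_const)
  then show ?thesis by (simp add: smooth_def)
qed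

definition slant :: "real \<Rightarrow> real" where "slant b = b\<^sup>2 / (2 + b\<^sup>2)"

lemma slant_bounds:
  assumes "0 \<le> b" "b < 1 / 2"
  shows "0 \<le> slant b" "slant b < 1 / 9"
proof -
  have "b\<^sup>2 < (1 / 2)\<^sup>2" using assms by (intro power_strict_mono) auto
  then show "0 \<le> slant b" "slant b < 1 / 9"
    by (auto simp: slant_def power_divide divide_less_eq add_pos_nonneg)
qed

context
  fixes b k c :: real
  assumes b: "0 \<le> b" "b < 1 / 2"
  defines "k \<equiv> slant b"
  defines "c \<equiv> 2 / (2 + b\<^sup>2)"
begin

lemma slope_bounds: "0 < 1 + p\<^sup>2 + q\<^sup>2" "1 + p\<^sup>2 + q\<^sup>2 \<noteq> k"
proof -
  have "1 + p\<^sup>2 + q\<^sup>2 \<ge> 1" by simp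
  then show "0 < 1 + p\<^sup>2 + q\<^sup>2" "1 + p\<^sup>2 + q\<^sup>2 \<noteq> k"
    using slant_bounds[OF b] by (linarith, unfold k_def, linarith)
qed

lemma BH_F_graph_frame_slant: "BH_F b (graph_frame p q) = c * busemann_density k (1 + p\<^sup>2 + q\<^sup>2)"
  using BH_F_graph_frame[of b p q] b by (simp add: c_def k_def slant_def)

lemma pdz_BH_F:
  "pdz 3 1 (BH_F b) (graph_frame p q) = c * (kappa k (1 + p\<^sup>2 + q\<^sup>2) * p)"
  "pdz 3 2 (BH_F b) (graph_frame p q) = c * (kappa k (1 + p\<^sup>2 + q\<^sup>2) * q)"
proof -
  have 1: "((\<lambda>t. 1 + (p + t)\<^sup>2 + q\<^sup>2) has_real_derivative 2 * p) (at 0)"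
    by (auto intro!: derivative_eq_intros)
  have 2: "((\<lambda>t. 1 + p\<^sup>2 + (q + t)\<^sup>2) has_real_derivative 2 * q) (at 0)"
    by (auto intro!: derivative_eq_intros)
  note D = busemann_density_has_derivative[OF slope_bounds(1)[of p q] slope_bounds(2)]
  have "((\<lambda>t. c * busemann_density k (1 + (p + t)\<^sup>2 + q\<^sup>2)) has_real_derivative
      c * (kappa k (1 + p\<^sup>2 + q\<^sup>2) / 2 * (2 * p))) (at 0)"
    by (intro DERIV_cmult DERIV_chain2[where f = "busemann_density k", OF _ 1]) (use D in simp)
  then show "pdz 3 1 (BH_F b) (graph_frame p q) = c * (kappa k (1 + p\<^sup>2 + q\<^sup>2) * p)"
    by (intro pd_eq_if) (simp add: graph_frame_add BH_F_graph_frame_slant)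
  have "((\<lambda>t. c * busemann_density k (1 + p\<^sup>2 + (q + t)\<^sup>2)) has_real_derivative
      c * (kappa k (1 + p\<^sup>2 + q\<^sup>2) / 2 * (2 * q))) (at 0)"
    by (intro DERIV_cmult DERIV_chain2[where f = "busemann_density k", OF _ 2]) (use D in simp)
  then show "pdz 3 2 (BH_F b) (graph_frame p q) = c * (kappa k (1 + p\<^sup>2 + q\<^sup>2) * q)"
    by (intro pd_eq_if) (simp add: graph_frame_add BH_F_graph_frame_slant)
qed

lemma pdz_pdz_BH_F:
  fixes p q :: real
  defines "K \<equiv> kappa k (1 + p\<^sup>2 + q\<^sup>2)" and "M \<equiv> mu k (1 + p\<^sup>2 + q\<^sup>2)"
  shows "pdz 3 1 (pdz 3 1 (BH_F b)) (graph_frame p q) = c * (K + M * p * p)"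
    "pdz 3 1 (pdz 3 2 (BH_F b)) (graph_frame p q) = c * (M * p * q)"
    "pdz 3 2 (pdz 3 1 (BH_F b)) (graph_frame p q) = c * (M * p * q)"
    "pdz 3 2 (pdz 3 2 (BH_F b)) (graph_frame p q) = c * (K + M * q * q)"
proof -
  have 1: "((\<lambda>t. 1 + (p + t)\<^sup>2 + q\<^sup>2) has_real_derivative 2 * p) (at 0)"
    by (auto intro!: derivative_eq_intros)
  have 2: "((\<lambda>t. 1 + p\<^sup>2 + (q + t)\<^sup>2) has_real_derivative 2 * q) (at 0)"
    by (auto intro!: derivative_eq_intros)
  have l: "((\<lambda>t. a + t) has_real_derivative 1) (at 0)" for a :: real
    by (auto intro!: derivative_eq_intros)
  note D = kappa_has_derivative[OF slope_bounds(1)[of p q] slope_bounds(2)]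
  have K1: "((\<lambda>t. kappa k (1 + (p + t)\<^sup>2 + q\<^sup>2)) has_real_derivative M / 2 * (2 * p)) (at 0)"
    by (intro DERIV_chain2[where f = "kappa k", OF _ 1]) (use D in \<open>simp add: M_def\<close>)
  have K2: "((\<lambda>t. kappa k (1 + p\<^sup>2 + (q + t)\<^sup>2)) has_real_derivative M / 2 * (2 * q)) (at 0)"
    by (intro DERIV_chain2[where f = "kappa k", OF _ 2]) (use D in \<open>simp add: M_def\<close>)
  show "pdz 3 1 (pdz 3 1 (BH_F b)) (graph_frame p q) = c * (K + M * p * p)"
    using DERIV_cmult[OF DERIV_mult[OF K1 l[of p]], of c]
    by (intro pd_eq_if) (simp add: graph_frame_add pdz_BH_F K_def algebra_simps)
  show "pdz 3 2 (pdz 3 2 (BH_F b)) (graph_frame p q) = c * (K + M * q * q)"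
    using DERIV_cmult[OF DERIV_mult[OF K2 l[of q]], of c]
    by (intro pd_eq_if) (simp add: graph_frame_add pdz_BH_F K_def algebra_simps)
  show "pdz 3 1 (pdz 3 2 (BH_F b)) (graph_frame p q) = c * (M * p * q)"
    using DERIV_cmult[OF DERIV_cmult_right[OF K1, of q], of c]
    by (intro pd_eq_if) (simp add: graph_frame_add pdz_BH_F algebra_simps)
  show "pdz 3 2 (pdz 3 1 (BH_F b)) (graph_frame p q) = c * (M * p * q)"
    using DERIV_cmult[OF DERIV_cmult_right[OF K2, of p], of c]
    by (intro pd_eq_if) (simp add: graph_frame_add pdz_BH_F algebra_simps)
qed

text \<open>
  The variation is taken in the vertical direction. Its coefficient involves the derivatives of the density in the
  slopes alone, and these can be computed from the values of the density on the graph frames. The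
  factor in front of the curvature is positive and cancels.
\<close>

lemma minimal_graph_equation:
  assumes "minimal b (graph_map f)"
  defines "p \<equiv> pdx 1 f" and "q \<equiv> pdx 2 f"
  defines "t \<equiv> \<lambda>x. 1 + (p x)\<^sup>2 + (q x)\<^sup>2"
  shows "(kappa k (t x) + mu k (t x) * p x * p x) * pdx 1 (pdx 1 f) x
    + mu k (t x) * p x * q x * (pdx 1 (pdx 2 f) x + pdx 2 (pdx 1 f) x)
    + (kappa k (t x) + mu k (t x) * q x * q x) * pdx 2 (pdx 2 f) x = 0" (is "?E = 0")
proof -
  have c: "c > 0" by (simp add: c_def add_pos_nonneg)
  have h: "mean_curvature b (graph_map f) (\<lambda>_. axis 3 1) x = 0"
    using assms(1) smooth_const unfolding minimal_def by blast
  have z: "pdx \<epsilon> (pdx \<eta> (\<lambda>u. graph_map f u $ j)) x = 0" if "j \<noteq> 3" for \<epsilon> \<eta> j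
    using that exhaust_3[of j] by (auto simp: graph_map_component pd_linear_coordinate pd_const)
  have e3: "(axis 3 1 :: real ^ 3) $ 1 = 0" "(axis 3 1 :: real ^ 3) $ 2 = 0" "(axis 3 1 :: real ^ 3) $ 3 = 1"
    by (simp_all add: axis_def)
  have "mean_curvature b (graph_map f) (\<lambda>_. axis 3 1) x = 1 / BH_F b (jac (graph_map f) x) * (c * ?E)"
    unfolding mean_curvature_def
    by (simp add: sum_3 sum_2 z e3 graph_map_component(3) jac_graph_map pdz_pdz_BH_F
        flip: p_def q_def) (simp add: p_def q_def t_def algebra_simps)
  moreover have "BH_F b (jac (graph_map f) x) \<noteq> 0"
    using slope_bounds[of "pdx 1 f x" "pdx 2 f x"] c
    by (simp add: jac_graph_map BH_F_graph_frame_slant busemann_density_def)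
  ultimately show ?thesis using c h by simp
qed

end

section \<open>Ellipticity of the equation\<close>

text \<open>
  The bounds below say that the eigenvalue across the gradient is \<open>kappa\<close>, of size
  \<open>1 / sqrt t\<close>, while the eigenvalue along the gradient is \<open>kappa + mu (t - 1)\<close>, positive and at
  most \<open>2 / (t sqrt t)\<close>. The smaller size along the gradient is what makes the position vector of
  the graph harmless in \<open>elliptic_form_position_bound\<close>.
\<close>

context
  fixes k t :: real
  assumes k: "0 \<le> k" "k < 1 / 9" and t: "1 \<le> t"
begin

lemma kappa_bounds: "2 / 3 \<le> sqrt t * kappa k t" "sqrt t * kappa k t \<le> 1"
proof -
  have d: "0 < t - k" "t - k \<le> t" using k t by auto
  have kt: "k \<le> k * t" using k t mult_left_mono[of 1 t k] by simp
  have e: "sqrt t * kappa k t = t * (t - 3 * k) / (t - k)\<^sup>2"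
    using t by (simp add: kappa_def flip: mult.assoc)
  have "2 / 3 * (t - k)\<^sup>2 \<le> t * (t - 3 * k)"
  proof -
    have "k * k \<le> k * t" using k t by (intro mult_left_mono) auto
    moreover have "9 * (k * t) \<le> 1 * t" using mult_right_mono[of "9 * k" 1 t] k t by simp
    moreover have "1 * t \<le> t * t" using t by (intro mult_right_mono) auto
    moreover have "9 * (k * t) \<le> t * t" using calculation by linarith
    moreover have "t * (t - 3 * k) - 2 / 3 * (t - k)\<^sup>2 = 1 / 3 * (t * t) - 5 / 3 * (k * t) - 2 / 3 * (k * k)"
      by (simp add: power2_eq_square field_simps)
    ultimately show ?thesis using kt k by linarith
  qed
  then show "2 / 3 \<le> sqrt t * kappa k t" unfolding e using d by (simp add: le_divide_eq)
  have "t * (t - 3 * k) \<le> (t - k)\<^sup>2"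
    using k t by (simp add: power2_eq_square algebra_simps add_nonneg_nonneg)
  then show "sqrt t * kappa k t \<le> 1" unfolding e using d by (simp add: divide_le_eq)
qed

lemma mu_nonpos: "mu k t \<le> 0"
proof -
  have "6 * k * t \<le> 2 / 3 * t" using k t by (intro mult_right_mono) auto
  moreover have "1 * t \<le> t * t" using t by (intro mult_right_mono) auto
  moreover have "k * k \<le> 1 / 9 * (1 / 9)" using k by (intro mult_mono) auto
  ultimately have "0 \<le> t\<^sup>2 - 6 * k * t - 3 * k\<^sup>2" using t unfolding power2_eq_square by linarith
  then show ?thesis using k t by (simp add: mu_def)
qed

lemma kappa_mu_radial:
  "kappa k t + mu k t * (t - 1) = ((1 + 2 * k) * t\<^sup>2 - 6 * k * (1 - k) * t - 3 * k\<^sup>2) / (sqrt t * (t - k) ^ 3)"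
proof -
  define d where "d = t - k"
  have d: "d > 0" "t = d + k" using k t by (auto simp: d_def)
  define r where "r = sqrt t"
  have r: "r > 0" "r * r = t" using t by (auto simp: r_def)
  have "kappa k t = t * (t - 3 * k) * d / (r * d ^ 3)"
  proof -
    have "r * (t - 3 * k) / d\<^sup>2 = r * r * (t - 3 * k) * d / (r * d ^ 3)"
      using d(1) r(1) by (simp add: power2_eq_square power3_eq_cube)
    then show ?thesis unfolding kappa_def r_def[symmetric] d_def[symmetric] r(2) .
  qed
  then show ?thesis
    unfolding mu_def r_def[symmetric] d_def[symmetric]
    by (simp add: diff_divide_distrib[symmetric] add_divide_distrib[symmetric])
       (simp add: d(2) power2_eq_square power3_eq_cube algebra_simps)
qed

lemma radial_pos: "0 < kappa k t + mu k t * (t - 1)"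
proof -
  have "6 * k * (1 - k) * t \<le> 6 * k * (1 - k) * t\<^sup>2"
    using k t by (intro mult_left_mono) (auto simp: power2_eq_square mult_nonneg_nonneg)
  moreover have "3 * k\<^sup>2 * 1 \<le> 3 * k\<^sup>2 * t\<^sup>2" using t by (intro mult_left_mono) auto
  \<comment> \<open>The numerator is at least its value with every power of t replaced by the square, which factors.\<close>
  moreover have "0 < t\<^sup>2 * ((1 - k) * (1 - 3 * k))" using k t by (intro mult_pos_pos) auto
  ultimately have "0 < (1 + 2 * k) * t\<^sup>2 - 6 * k * (1 - k) * t - 3 * k\<^sup>2"
    by (simp add: power2_eq_square algebra_simps)
  then show ?thesis unfolding kappa_mu_radial using k t by (intro divide_pos_pos mult_pos_pos zero_less_power) auto
qed

lemma radial_upper: "t * sqrt t * (kappa k t + mu k t * (t - 1)) \<le> 2"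
proof -
  define d where "d = t - k"
  have d: "d \<ge> 8 / 9 * t" "d > 0" using k t by (auto simp: d_def)
  have "t * sqrt t * (kappa k t + mu k t * (t - 1)) = t * ((1 + 2 * k) * t\<^sup>2 - 6 * k * (1 - k) * t - 3 * k\<^sup>2) / d ^ 3"
    unfolding kappa_mu_radial using t by (simp add: d_def)
  also have "\<dots> \<le> t * (11 / 9 * t\<^sup>2) / d ^ 3"
  proof -
    have "(1 + 2 * k) * t\<^sup>2 \<le> 11 / 9 * t\<^sup>2" using k by (intro mult_right_mono) auto
    moreover have "0 \<le> 6 * k * (1 - k) * t" using k t by simp
    ultimately have "(1 + 2 * k) * t\<^sup>2 - 6 * k * (1 - k) * t - 3 * k\<^sup>2 \<le> 11 / 9 * t\<^sup>2"
      using zero_le_power2[of k] by linarith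
    then show ?thesis using t d by (intro divide_right_mono mult_left_mono) auto
  qed
  also have "\<dots> \<le> 2"
  proof -
    have "(8 / 9 * t) ^ 3 \<le> d ^ 3" using d t by (intro power_mono) auto
    then have "512 / 729 * t ^ 3 \<le> d ^ 3" by (simp add: power_mult_distrib power_divide)
    moreover have "t * (11 / 9 * t\<^sup>2) = 11 / 9 * t ^ 3" by (simp add: power2_eq_square power3_eq_cube)
    moreover have "0 \<le> t ^ 3" using t by simp
    ultimately have "t * (11 / 9 * t\<^sup>2) \<le> 2 * d ^ 3" by linarith
    then show ?thesis using d by (simp add: divide_le_eq)
  qed
  finally show ?thesis .
qed

end

text \<open>
  The Hessian of the density at the slope \<open>(p, q)\<close> as a bilinear form in \<open>(a\<^sub>1, a\<^sub>2)\<close> and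
  \<open>(b\<^sub>1, b\<^sub>2)\<close>, up to the constant factor.
\<close>

definition elliptic_form :: "real \<Rightarrow> real \<Rightarrow> real \<Rightarrow> real \<Rightarrow> real \<Rightarrow> real \<Rightarrow> real \<Rightarrow> real" where
  "elliptic_form k p q a1 a2 b1 b2 = kappa k (1 + p\<^sup>2 + q\<^sup>2) * (a1 * b1 + a2 * b2)
     + mu k (1 + p\<^sup>2 + q\<^sup>2) * (p * a1 + q * a2) * (p * b1 + q * b2)"

text \<open>
  As \<open>mu\<close> is not positive, the form is smallest in the direction of the gradient.
\<close>

lemma elliptic_form_lower:
  assumes "0 \<le> k" "k < 1 / 9"
  defines "t \<equiv> \<lambda>p q. 1 + p\<^sup>2 + q\<^sup>2"
  shows "(kappa k (t p q) + mu k (t p q) * (t p q - 1)) * (a1\<^sup>2 + a2\<^sup>2) \<le> elliptic_form k p q a1 a2 a1 a2"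
proof -
  have "1 \<le> t p q" by (simp add: t_def)
  then have m: "mu k (t p q) \<le> 0" by (rule mu_nonpos[OF assms(1,2)])
  have "(p * a1 + q * a2)\<^sup>2 + (p * a2 - q * a1)\<^sup>2 = (t p q - 1) * (a1\<^sup>2 + a2\<^sup>2)"
    by (simp add: t_def power2_eq_square algebra_simps)
  then have "(p * a1 + q * a2)\<^sup>2 \<le> (t p q - 1) * (a1\<^sup>2 + a2\<^sup>2)"
    using zero_le_power2[of "p * a2 - q * a1"] by linarith
  from mult_left_mono_neg[OF this m] show ?thesis
    by (simp add: elliptic_form_def t_def power2_eq_square algebra_simps)
qed

lemma elliptic_form_nonneg:
  assumes "0 \<le> k" "k < 1 / 9"
  shows "0 \<le> elliptic_form k p q a1 a2 a1 a2"
proof -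
  have "0 \<le> (kappa k (1 + p\<^sup>2 + q\<^sup>2) + mu k (1 + p\<^sup>2 + q\<^sup>2) * (1 + p\<^sup>2 + q\<^sup>2 - 1)) * (a1\<^sup>2 + a2\<^sup>2)"
    using radial_pos[OF assms, of "1 + p\<^sup>2 + q\<^sup>2"] by (intro mult_nonneg_nonneg) auto
  then show ?thesis using elliptic_form_lower[OF assms, of p q a1 a2] by linarith
qed

lemma elliptic_form_definite:
  assumes "0 \<le> k" "k < 1 / 9" and z: "elliptic_form k p q a1 a2 a1 a2 = 0"
  shows "a1 = 0 \<and> a2 = 0"
proof -
  have "(kappa k (1 + p\<^sup>2 + q\<^sup>2) + mu k (1 + p\<^sup>2 + q\<^sup>2) * (1 + p\<^sup>2 + q\<^sup>2 - 1)) * (a1\<^sup>2 + a2\<^sup>2) \<le> 0"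
    using elliptic_form_lower[OF assms(1,2), of p q a1 a2] z by simp
  then have "a1\<^sup>2 + a2\<^sup>2 \<le> 0"
    using radial_pos[OF assms(1,2), of "1 + p\<^sup>2 + q\<^sup>2"] by (simp add: mult_le_0_iff)
  then show ?thesis by (simp add: sum_power2_le_zero_iff)
qed

text \<open>
  The weight \<open>D\<close> will be \<open>1 + p\<^sup>2\<close>, the reciprocal of the derivative of \<open>arctan\<close>.
  The inequality is the positivity of the form at \<open>x a - y D b\<close>, divided by \<open>D\<close>.
\<close>

lemma elliptic_form_young:
  assumes "0 \<le> k" "k < 1 / 9" "0 < D"
  shows "2 * x * y * elliptic_form k p q a1 a2 b1 b2
    \<le> x\<^sup>2 * elliptic_form k p q a1 a2 a1 a2 / D + y\<^sup>2 * D * elliptic_form k p q b1 b2 b1 b2"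
proof -
  have "0 \<le> elliptic_form k p q (x * a1 - y * D * b1) (x * a2 - y * D * b2) (x * a1 - y * D * b1) (x * a2 - y * D * b2)"
    by (rule elliptic_form_nonneg[OF assms(1,2)])
  also have "\<dots> = x\<^sup>2 * elliptic_form k p q a1 a2 a1 a2 + y\<^sup>2 * D * D * elliptic_form k p q b1 b2 b1 b2 - 2 * x * y * D * elliptic_form k p q a1 a2 b1 b2"
    by (simp add: elliptic_form_def power2_eq_square algebra_simps)
  also have "\<dots> = D * (x\<^sup>2 * elliptic_form k p q a1 a2 a1 a2 / D + y\<^sup>2 * D * elliptic_form k p q b1 b2 b1 b2 - 2 * x * y * elliptic_form k p q a1 a2 b1 b2)"
    using assms(3) by (simp add: algebra_simps)
  finally show ?thesis using assms(3) by (simp add: zero_le_mult_iff)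
qed

text \<open>
  The vector \<open>(X + Z p, Y + Z q)\<close> is half the gradient of \<open>x\<^sub>1\<^sup>2 + x\<^sub>2\<^sup>2 + f\<^sup>2\<close> at the
  point \<open>(X, Y, Z)\<close> of the graph. Its part \<open>Z (p, q)\<close> may be large, of the order of
  \<open>sqrt t\<close>, but it points along the gradient, where the form is smaller by a factor \<open>t\<close>. Both
  parts therefore contribute equally, as for the tangential gradient on the graph.
\<close>

lemma elliptic_form_position_bound:
  fixes p q X Y Z :: real
  assumes k: "0 \<le> k" "k < 1 / 9"
  defines "t \<equiv> 1 + p\<^sup>2 + q\<^sup>2"
  shows "t * elliptic_form k p q (X + Z * p) (Y + Z * q) (X + Z * p) (Y + Z * q)
    \<le> 4 * sqrt t * (X\<^sup>2 + Y\<^sup>2 + Z\<^sup>2)"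
proof -
  have t: "1 \<le> t" by (simp add: t_def)
  define r where "r = sqrt t"
  have r: "r > 0" "t = r * r" using t by (auto simp: r_def)
  have "0 \<le> elliptic_form k p q (X - Z * p) (Y - Z * q) (X - Z * p) (Y - Z * q)"
    by (rule elliptic_form_nonneg[OF k])
  then have "elliptic_form k p q (X + Z * p) (Y + Z * q) (X + Z * p) (Y + Z * q)
      \<le> 2 * elliptic_form k p q X Y X Y + 2 * (Z\<^sup>2 * elliptic_form k p q p q p q)"
    by (simp add: elliptic_form_def power2_eq_square algebra_simps)
  moreover have "elliptic_form k p q X Y X Y \<le> (X\<^sup>2 + Y\<^sup>2) / r"
  proof -
    have "elliptic_form k p q X Y X Y = kappa k t * (X\<^sup>2 + Y\<^sup>2) + mu k t * (p * X + q * Y)\<^sup>2"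
      by (simp add: elliptic_form_def t_def power2_eq_square)
    also have "\<dots> \<le> kappa k t * (X\<^sup>2 + Y\<^sup>2)"
      using mu_nonpos[OF k t] by (simp add: mult_nonpos_nonneg)
    also have "\<dots> \<le> 1 / r * (X\<^sup>2 + Y\<^sup>2)"
      using kappa_bounds(2)[OF k t] r(1) by (intro mult_right_mono) (auto simp: r_def field_simps)
    finally show ?thesis by simp
  qed
  moreover have "elliptic_form k p q p q p q \<le> 2 / r"
  proof -
    have "elliptic_form k p q p q p q = (t - 1) * (kappa k t + mu k t * (t - 1))"
      by (simp add: elliptic_form_def t_def power2_eq_square algebra_simps)
    also have "\<dots> \<le> t * (kappa k t + mu k t * (t - 1))"
      using radial_pos[OF k t] by (intro mult_right_mono) auto
    also have "\<dots> \<le> 2 / r" using radial_upper[OF k t] r(1) by (simp add: r_def field_simps)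
    finally show ?thesis .
  qed
  then have "Z\<^sup>2 * elliptic_form k p q p q p q \<le> Z\<^sup>2 * (2 / r)" by (rule mult_left_mono) auto
  ultimately have "elliptic_form k p q (X + Z * p) (Y + Z * q) (X + Z * p) (Y + Z * q)
    \<le> 2 * ((X\<^sup>2 + Y\<^sup>2) / r) + 2 * (Z\<^sup>2 * (2 / r))" by linarith
  then have "t * elliptic_form k p q (X + Z * p) (Y + Z * q) (X + Z * p) (Y + Z * q)
    \<le> t * (2 * ((X\<^sup>2 + Y\<^sup>2) / r) + 2 * (Z\<^sup>2 * (2 / r)))" using t by (intro mult_left_mono) auto
  also have "\<dots> = 2 * r * (X\<^sup>2 + Y\<^sup>2) + 4 * r * Z\<^sup>2"
    unfolding r(2) using r(1) by (simp add: field_simps)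
  also have "\<dots> \<le> 4 * r * (X\<^sup>2 + Y\<^sup>2 + Z\<^sup>2)"
    using r(1) mult_nonneg_nonneg[of r "X\<^sup>2 + Y\<^sup>2"] by (simp add: algebra_simps)
  finally show ?thesis by (simp add: r_def)
qed

section \<open>Integration by parts on Euclidean spaces\<close>

lemma integrable_compact_support:
  fixes g :: "'a::euclidean_space \<Rightarrow> real"
  assumes "continuous_on UNIV g" and "\<And>x. norm x > R \<Longrightarrow> g x = 0"
  shows "integrable lborel g"
proof -
  have "integrable lborel (\<lambda>x. indicator (cball 0 R) x *\<^sub>R g x)"
    by (rule borel_integrable_compact) (auto intro: continuous_on_subset[OF assms(1)])
  moreover have "indicator (cball 0 R) x *\<^sub>R g x = g x" for x
    using assms(2)[of x] by (cases "norm x \<le> R") auto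
  ultimately show ?thesis by (simp only:)
qed

lemma integral_lborel_translate:
  fixes g :: "'a::euclidean_space \<Rightarrow> real"
  assumes "g \<in> borel_measurable borel"
  shows "(\<integral>x. g (x + a) \<partial>lborel) = (\<integral>x. g x \<partial>lborel)"
proof -
  have "(\<integral>x. g x \<partial>lborel) = (\<integral>x. g x \<partial>distr lborel borel ((+) a))"
    by (simp add: lborel_distr_plus)
  also have "\<dots> = (\<integral>x. g (a + x) \<partial>lborel)"
    by (rule integral_distr) (use assms in auto)
  finally show ?thesis by (simp add: add.commute)
qed

lemma has_derivative_along_line:
  fixes g :: "'a::real_normed_vector \<Rightarrow> real"
  assumes "(g has_derivative D) (at (x + t *\<^sub>R v))"
  shows "((\<lambda>s. g (x + s *\<^sub>R v)) has_real_derivative D v) (at t)"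
proof -
  have "((\<lambda>s. g (x + s *\<^sub>R v)) has_derivative (\<lambda>s. D (s *\<^sub>R v))) (at t)"
    by (rule has_derivative_compose[of "\<lambda>s. x + s *\<^sub>R v" _ _ _ g]) (auto intro!: derivative_eq_intros assms)
  moreover have "D (s *\<^sub>R v) = D v * s" for s
    using linear_cmul[OF has_derivative_linear[OF assms]] by (simp add: mult.commute)
  ultimately show ?thesis by (simp add: has_field_derivative_def)
qed

text \<open>
  Dominated convergence: on the support of the product the difference quotients are bounded by the
  mean value theorem. The support condition is put on the product, so that either factor may be the one
  with compact support. All integrations by parts are reduced to this
  limit and the translation invariance of Lebesgue measure.
\<close>

lemma difference_quotient_integral_limit:
  fixes B \<eta> :: "'a::euclidean_space \<Rightarrow> real"
  assumes B: "\<And>x. (B has_derivative B' x) (at x)"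
    and cB: "continuous_on UNIV (\<lambda>x. B' x v)" and c\<eta>: "continuous_on UNIV \<eta>"
    and supp: "\<And>x h. norm x > R \<Longrightarrow> 0 \<le> h \<Longrightarrow> h \<le> 1 \<Longrightarrow> (B (x + h *\<^sub>R v) - B x) * \<eta> x = 0"
  shows "(\<lambda>n. \<integral>x. (B (x + (1 / real (Suc n)) *\<^sub>R v) - B x) * real (Suc n) * \<eta> x \<partial>lborel)
      \<longlonglongrightarrow> (\<integral>x. B' x v * \<eta> x \<partial>lborel)"
proof -
  have contB: "continuous_on UNIV B"
    using B by (meson continuous_at_imp_continuous_on has_derivative_continuous)
  have line: "((\<lambda>t. B (x + t *\<^sub>R v)) has_real_derivative B' (x + t *\<^sub>R v) v) (at t)" for x t
    by (rule has_derivative_along_line[OF B])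
  let ?S = "cball (0 :: 'a) R" and ?S' = "cball (0 :: 'a) (R + norm v)"
  have "bounded ((\<lambda>x. B' x v) ` ?S')" "bounded (\<eta> ` ?S)"
    using continuous_on_subset[OF cB] continuous_on_subset[OF c\<eta>]
    by (auto intro!: compact_imp_bounded compact_continuous_image)
  then obtain M m where "\<forall>x\<in>?S'. \<bar>B' x v\<bar> \<le> M" and "\<forall>x\<in>?S. \<bar>\<eta> x\<bar> \<le> m"
    unfolding bounded_iff by auto
  then have M: "\<And>x. x \<in> ?S' \<Longrightarrow> \<bar>B' x v\<bar> \<le> M" and m: "\<And>x. x \<in> ?S \<Longrightarrow> \<bar>\<eta> x\<bar> \<le> m"
    by blast+
  have bound: "\<bar>(B (x + (1 / real (Suc n)) *\<^sub>R v) - B x) * real (Suc n) * \<eta> x\<bar>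
      \<le> indicator ?S x * (M * m)" for x n
  proof (cases "norm x \<le> R")
    case True
    define h where "h = 1 / real (Suc n)"
    have h: "0 < h" "h \<le> 1" by (auto simp: h_def)
    obtain s where s: "0 < s" "s < h" "B (x + h *\<^sub>R v) - B (x + 0 *\<^sub>R v) = (h - 0) * B' (x + s *\<^sub>R v) v"
      using MVT2[OF h(1), of "\<lambda>t. B (x + t *\<^sub>R v)" "\<lambda>t. B' (x + t *\<^sub>R v) v"] line by blast
    have "norm (x + s *\<^sub>R v) \<le> R + 1 * norm v"
      using s h True mult_left_le_one_le[of "norm v" s] by (intro norm_triangle_le add_mono) auto
    then have "\<bar>B' (x + s *\<^sub>R v) v\<bar> \<le> M" using M by simp
    moreover have "(B (x + h *\<^sub>R v) - B x) * real (Suc n) = B' (x + s *\<^sub>R v) v"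
      using s(3) by (simp add: h_def)
    moreover have "\<bar>\<eta> x\<bar> \<le> m" using m True by simp
    ultimately have "\<bar>(B (x + h *\<^sub>R v) - B x) * real (Suc n) * \<eta> x\<bar> \<le> M * m"
      unfolding abs_mult by (intro mult_mono) auto
    then show ?thesis using True by (simp add: h_def)
  next
    case False
    then have "(B (x + (1 / real (Suc n)) *\<^sub>R v) - B x) * \<eta> x = 0" by (intro supp) auto
    then show ?thesis using False by auto
  qed
  show ?thesis
  proof (rule integral_dominated_convergence[where w = "\<lambda>x. indicator ?S x * (M * m)"])
    have "continuous_on UNIV (\<lambda>x. B' x v * \<eta> x)"
      by (intro continuous_on_mult cB c\<eta>)
    then show "(\<lambda>x. B' x v * \<eta> x) \<in> borel_measurable lborel"
      by (simp add: borel_measurable_continuous_onI)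
    have "continuous_on UNIV (\<lambda>x. (B (x + (1 / real (Suc n)) *\<^sub>R v) - B x) * real (Suc n) * \<eta> x)" for n
      by (intro continuous_intros c\<eta> continuous_on_compose2[OF contB]) auto
    then show "(\<lambda>x. (B (x + (1 / real (Suc n)) *\<^sub>R v) - B x) * real (Suc n) * \<eta> x) \<in> borel_measurable lborel" for n
      by (simp add: borel_measurable_continuous_onI)
    show "integrable lborel (\<lambda>x. indicator ?S x * (M * m))"
      by (intro integrable_mult_left) (use emeasure_bounded_finite[OF bounded_cball[of "0 :: 'a" R]] in \<open>auto simp: integrable_indicator_iff\<close>)
    show "AE x in lborel. (\<lambda>n. (B (x + (1 / real (Suc n)) *\<^sub>R v) - B x) * real (Suc n) * \<eta> x) \<longlonglongrightarrow> B' x v * \<eta> x"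
    proof (rule AE_I2)
      fix x
      have "filterlim (\<lambda>n. 1 / real (Suc n)) (at (0 :: real)) sequentially"
        unfolding filterlim_at using LIMSEQ_inverse_real_of_nat[unfolded inverse_eq_divide] by auto
      from filterlim_compose[OF line[of x 0, unfolded has_field_derivative_iff] this]
      have "(\<lambda>n. (B (x + (1 / real (Suc n)) *\<^sub>R v) - B x) * real (Suc n)) \<longlonglongrightarrow> B' x v"
        by simp
      then show "(\<lambda>n. (B (x + (1 / real (Suc n)) *\<^sub>R v) - B x) * real (Suc n) * \<eta> x) \<longlonglongrightarrow> B' x v * \<eta> x"
        by (intro tendsto_mult tendsto_const)
    qed
    show "AE x in lborel. norm ((B (x + (1 / real (Suc n)) *\<^sub>R v) - B x) * real (Suc n) * \<eta> x) \<le> indicator ?S x * (M * m)" for n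
      using bound by simp
  qed
qed

text \<open>
  The integral of a difference quotient vanishes because translations preserve the integral.
\<close>

lemma integral_directional_derivative_zero:
  fixes g :: "'a::euclidean_space \<Rightarrow> real"
  assumes g: "\<And>x. (g has_derivative g' x) (at x)"
    and cg: "continuous_on UNIV (\<lambda>x. g' x v)" and supp: "\<And>x. norm x > R \<Longrightarrow> g x = 0"
  shows "(\<integral>x. g' x v \<partial>lborel) = 0"
proof -
  have cont: "continuous_on UNIV g"
    using g by (meson continuous_at_imp_continuous_on has_derivative_continuous)
  have shifted: "g (x + h *\<^sub>R v) = 0" if "norm x > R + norm v" "0 \<le> h" "h \<le> 1" for x h
  proof (rule supp)
    have "norm x \<le> norm (x + h *\<^sub>R v) + norm (h *\<^sub>R v)" by (metis add_diff_cancel_right' norm_triangle_ineq4)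
    moreover have "norm (h *\<^sub>R v) \<le> 1 * norm v" using that mult_left_le_one_le[of "norm v" h] by simp
    ultimately show "norm (x + h *\<^sub>R v) > R" using that by linarith
  qed
  have lim: "(\<lambda>n. \<integral>x. (g (x + (1 / real (Suc n)) *\<^sub>R v) - g x) * real (Suc n) * 1 \<partial>lborel)
      \<longlonglongrightarrow> (\<integral>x. g' x v * 1 \<partial>lborel)"
  proof (rule difference_quotient_integral_limit[OF g cg, of _ "R + norm v"])
    fix x :: 'a and h :: real assume *: "norm x > R + norm v" "0 \<le> h" "h \<le> 1"
    then have "norm x > R" using norm_ge_zero[of v] by linarith
    then show "(g (x + h *\<^sub>R v) - g x) * 1 = 0" using shifted[OF *] supp by simp
  qed auto
  have "(\<integral>x. (g (x + (1 / real (Suc n)) *\<^sub>R v) - g x) * real (Suc n) * 1 \<partial>lborel) = 0" for n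
  proof -
    have int: "integrable lborel g" by (rule integrable_compact_support[OF cont supp])
    have int': "integrable lborel (\<lambda>x. g (x + (1 / real (Suc n)) *\<^sub>R v))"
      by (rule integrable_compact_support[of _ "R + norm v"])
         (auto intro!: continuous_on_compose2[OF cont] continuous_intros shifted)
    have "(\<integral>x. (g (x + (1 / real (Suc n)) *\<^sub>R v) - g x) * real (Suc n) * 1 \<partial>lborel)
      = ((\<integral>x. g (x + (1 / real (Suc n)) *\<^sub>R v) \<partial>lborel) - (\<integral>x. g x \<partial>lborel)) * real (Suc n)"
      using int int' by (simp only: mult_1_right integral_mult_left_zero Bochner_Integration.integral_diff)
    also have "\<dots> = 0"
      using integral_lborel_translate[of g] cont by (simp add: borel_measurable_continuous_onI)
    finally show ?thesis .
  qed
  then show ?thesis using lim LIMSEQ_unique[OF lim, of 0] by simp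
qed

lemma has_derivative_vanishing_outside:
  fixes g :: "'a::euclidean_space \<Rightarrow> real"
  assumes "(g has_derivative D) (at x)" "\<And>x. norm x > R \<Longrightarrow> g x = 0" "norm x > R"
  shows "D v = 0"
proof -
  have "open {x :: 'a. norm x > R}" by (intro open_Collect_less continuous_intros)
  then have "(g has_derivative (\<lambda>_. 0)) (at x)"
    using assms(2,3) by (intro has_derivative_transform_within_open[OF has_derivative_const[of 0]]) auto
  then have "D = (\<lambda>_. 0)" using assms(1) has_derivative_unique by blast
  then show ?thesis by simp
qed

text \<open>
  For smooth functions this is two integrations by parts and the symmetry of second derivatives. For
  \<open>C\<^sup>1\<close> functions the derivative along \<open>v\<close> is replaced by a difference quotient, which is moved from
  \<open>B\<close> to \<open>\<eta>\<close> by one integration by parts along \<open>w\<close> and a translation; so no second derivative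
  appears.
\<close>

lemma integral_derivative_swap:
  fixes B \<eta> :: "'a::euclidean_space \<Rightarrow> real"
  assumes B: "\<And>x. (B has_derivative B' x) (at x)"
    and \<eta>: "\<And>x. (\<eta> has_derivative \<eta>' x) (at x)"
    and cB: "\<And>u. continuous_on UNIV (\<lambda>x. B' x u)" and c\<eta>: "\<And>u. continuous_on UNIV (\<lambda>x. \<eta>' x u)"
    and supp: "\<And>x. norm x > R \<Longrightarrow> \<eta> x = 0"
  shows "(\<integral>x. B' x v * \<eta>' x w \<partial>lborel) = (\<integral>x. B' x w * \<eta>' x v \<partial>lborel)"
proof -
  have contB: "continuous_on UNIV B" and cont\<eta>: "continuous_on UNIV \<eta>"
    using B \<eta> by (meson continuous_at_imp_continuous_on has_derivative_continuous)+
  have supp': "\<eta>' x u = 0" if "norm x > R" for x u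
    by (rule has_derivative_vanishing_outside[OF \<eta> supp that])
  let ?h = "\<lambda>n. 1 / real (Suc n)"
  have lim1: "(\<lambda>n. \<integral>x. (B (x + ?h n *\<^sub>R v) - B x) * real (Suc n) * \<eta>' x w \<partial>lborel)
      \<longlonglongrightarrow> (\<integral>x. B' x v * \<eta>' x w \<partial>lborel)"
    by (rule difference_quotient_integral_limit[OF B cB c\<eta>, of R]) (simp add: supp')
  have shifted: "\<eta> (x + h *\<^sub>R - v) = 0" if "norm x > R + norm v" "0 \<le> h" "h \<le> 1" for x h
  proof (rule supp)
    have "norm x \<le> norm (x + h *\<^sub>R - v) + norm (h *\<^sub>R - v)" by (metis add_diff_cancel_right' norm_triangle_ineq4)
    moreover have "norm (h *\<^sub>R - v) \<le> 1 * norm v" using that mult_left_le_one_le[of "norm v" h] by simp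
    ultimately show "norm (x + h *\<^sub>R - v) > R" using that by linarith
  qed
  have far: "\<eta> x = 0" if "norm x > R + norm v" for x
    using that norm_ge_zero[of v] by (intro supp) linarith
  have lim2: "(\<lambda>n. \<integral>x. (\<eta> (x + ?h n *\<^sub>R - v) - \<eta> x) * real (Suc n) * B' x w \<partial>lborel)
      \<longlonglongrightarrow> (\<integral>x. \<eta>' x (- v) * B' x w \<partial>lborel)"
    by (rule difference_quotient_integral_limit[OF \<eta> c\<eta> cB, of "R + norm v"]) (simp only: shifted far diff_self mult_zero_left)
  have eq: "(\<integral>x. (B (x + ?h n *\<^sub>R v) - B x) * real (Suc n) * \<eta>' x w \<partial>lborel)
    = - (\<integral>x. (\<eta> (x + ?h n *\<^sub>R - v) - \<eta> x) * real (Suc n) * B' x w \<partial>lborel)" for n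
  proof -
    let ?a = "?h n *\<^sub>R v"
    have a: "((\<lambda>x. (B (x + ?a) - B x) * \<eta> x) has_derivative
        (\<lambda>u. (B (x + ?a) - B x) * \<eta>' x u + (B' (x + ?a) u - B' x u) * \<eta> x)) (at x)" for x
    proof (intro has_derivative_mult has_derivative_diff B \<eta>)
      show "((\<lambda>x. B (x + ?a)) has_derivative (\<lambda>u. B' (x + ?a) u)) (at x)"
        by (rule has_derivative_compose[of "\<lambda>x. x + ?a" _ _ _ B]) (auto intro!: derivative_eq_intros B)
    qed
    have cs: "continuous_on UNIV (\<lambda>x. B (x + ?a))" "continuous_on UNIV (\<lambda>x. B' (x + ?a) w)"
      by (intro continuous_on_compose2[OF contB] continuous_on_compose2[OF cB] continuous_intros; simp)+
    have cr: "continuous_on UNIV (\<lambda>x. \<eta> (x + ?h n *\<^sub>R - v))"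
      by (intro continuous_on_compose2[OF cont\<eta>] continuous_intros; simp)
    have i1: "integrable lborel (\<lambda>x. (B (x + ?a) - B x) * \<eta>' x w)"
      by (rule integrable_compact_support[of _ R]) (auto intro!: continuous_intros cs contB c\<eta> simp: supp' simp del: of_nat_Suc)
    have i2: "integrable lborel (\<lambda>x. B' (x + ?a) w * \<eta> x)"
      by (rule integrable_compact_support[of _ R]) (auto intro!: continuous_intros cs cont\<eta> simp: supp simp del: of_nat_Suc)
    have i3: "integrable lborel (\<lambda>x. B' x w * \<eta> x)"
      by (rule integrable_compact_support[of _ R]) (auto intro!: continuous_intros cB cont\<eta> simp: supp simp del: of_nat_Suc)
    have i4: "integrable lborel (\<lambda>x. B' x w * \<eta> (x + ?h n *\<^sub>R - v))"
    proof (rule integrable_compact_support[of _ "R + norm v"])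
      show "continuous_on UNIV (\<lambda>x. B' x w * \<eta> (x + ?h n *\<^sub>R - v))"
        by (intro continuous_on_mult cB cr)
      show "B' x w * \<eta> (x + ?h n *\<^sub>R - v) = 0" if "norm x > R + norm v" for x
        using shifted[OF that, of "?h n"] by (simp del: of_nat_Suc)
    qed
    have "0 = (\<integral>x. (B (x + ?a) - B x) * \<eta>' x w + (B' (x + ?a) w - B' x w) * \<eta> x \<partial>lborel)"
      by (rule integral_directional_derivative_zero[OF a, of _ R, symmetric])
         (auto intro!: continuous_intros cs contB c\<eta> cB cont\<eta> simp: supp simp del: of_nat_Suc)
    also have "\<dots> = (\<integral>x. (B (x + ?a) - B x) * \<eta>' x w + (B' (x + ?a) w * \<eta> x - B' x w * \<eta> x) \<partial>lborel)"
      by (simp add: left_diff_distrib)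
    also have "\<dots> = (\<integral>x. (B (x + ?a) - B x) * \<eta>' x w \<partial>lborel)
        + ((\<integral>x. B' (x + ?a) w * \<eta> x \<partial>lborel) - (\<integral>x. B' x w * \<eta> x \<partial>lborel))"
      using i1 i2 i3 by simp
    also have "(\<integral>x. B' (x + ?a) w * \<eta> x \<partial>lborel) = (\<integral>x. B' x w * \<eta> (x + ?h n *\<^sub>R - v) \<partial>lborel)"
    proof -
      have "(\<lambda>x. B' x w * \<eta> (x + ?h n *\<^sub>R - v)) \<in> borel_measurable borel"
        by (intro borel_measurable_continuous_onI continuous_on_mult cB cr)
      from integral_lborel_translate[OF this, of ?a] show ?thesis by simp
    qed
    finally have "(\<integral>x. (B (x + ?a) - B x) * \<eta>' x w \<partial>lborel)
      = - ((\<integral>x. B' x w * \<eta> (x + ?h n *\<^sub>R - v) \<partial>lborel) - (\<integral>x. B' x w * \<eta> x \<partial>lborel))" by linarith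
    also have "(\<integral>x. B' x w * \<eta> (x + ?h n *\<^sub>R - v) \<partial>lborel) - (\<integral>x. B' x w * \<eta> x \<partial>lborel)
      = (\<integral>x. B' x w * \<eta> (x + ?h n *\<^sub>R - v) - B' x w * \<eta> x \<partial>lborel)"
      by (rule Bochner_Integration.integral_diff[OF i4 i3, symmetric])
    also have "\<dots> = (\<integral>x. (\<eta> (x + ?h n *\<^sub>R - v) - \<eta> x) * B' x w \<partial>lborel)"
      by (intro Bochner_Integration.integral_cong refl) (simp add: algebra_simps)
    finally have "(\<integral>x. (B (x + ?a) - B x) * \<eta>' x w \<partial>lborel) * real (Suc n)
      = - (\<integral>x. (\<eta> (x + ?h n *\<^sub>R - v) - \<eta> x) * B' x w \<partial>lborel) * real (Suc n)" by simp
    then show ?thesis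
      unfolding mult_minus_left integral_mult_left_zero[symmetric] by (simp only: mult.assoc mult.commute mult.left_commute)
  qed
  have "\<eta>' x (- v) = - \<eta>' x v" for x
    by (rule linear_neg[OF has_derivative_linear[OF \<eta>]])
  then have "(\<integral>x. \<eta>' x (- v) * B' x w \<partial>lborel) = - (\<integral>x. B' x w * \<eta>' x v \<partial>lborel)"
    by (simp add: mult.commute)
  then show ?thesis
    using LIMSEQ_unique[OF lim1] tendsto_minus[OF lim2] unfolding eq by simp
qed

lemma continuous_nonneg_integral_zero:
  fixes g :: "'a::euclidean_space \<Rightarrow> real"
  assumes c: "continuous_on UNIV g" and "\<And>x. 0 \<le> g x" and i: "integrable lborel g"
    and "(\<integral>x. g x \<partial>lborel) = 0"
  shows "g x = 0"
proof (rule ccontr)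
  assume "g x \<noteq> 0"
  have "AE x in lborel. g x = 0" using integral_nonneg_eq_0_iff_AE[OF i] assms by auto
  moreover have o: "open {x. g x \<noteq> 0}" by (intro open_Collect_neq c continuous_intros)
  ultimately have "{x. g x \<noteq> 0} \<in> null_sets lborel" by (subst AE_iff_null_sets) auto
  then have "negligible {x. g x \<noteq> 0}"
    unfolding negligible_iff_null_sets by (rule null_sets_completionI)
  then show False using open_not_negligible[OF o] \<open>g x \<noteq> 0\<close> by auto
qed

section \<open>Gradients, cutoffs and mixed derivatives in the plane\<close>

text \<open>
  Derivatives in the plane are handled through their two components, so that the product and chain
  rules act on explicit partial derivatives.
\<close>

definition has_grad :: "(real ^ 2 \<Rightarrow> real) \<Rightarrow> real \<Rightarrow> real \<Rightarrow> real ^ 2 \<Rightarrow> bool" where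
  "has_grad g a b x \<longleftrightarrow> (g has_derivative (\<lambda>h. a * h $ 1 + b * h $ 2)) (at x)"

lemma has_grad_eq: "has_grad g a b x \<Longrightarrow> a = a' \<Longrightarrow> b = b' \<Longrightarrow> has_grad g a' b' x"
  by simp

lemma has_grad_const: "has_grad (\<lambda>_. c) 0 0 x"
  by (simp add: has_grad_def)

lemma has_grad_coord: "has_grad (\<lambda>x. x $ 1) 1 0 x" "has_grad (\<lambda>x. x $ 2) 0 1 x"
  unfolding has_grad_def by (auto intro!: bounded_linear_imp_has_derivative bounded_linear_vec_nth)

lemma has_grad_add: "has_grad g a b x \<Longrightarrow> has_grad h c d x \<Longrightarrow> has_grad (\<lambda>x. g x + h x) (a + c) (b + d) x"
  unfolding has_grad_def by (drule (1) has_derivative_add) (simp add: algebra_simps)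

lemma has_grad_mult:
  "has_grad g a b x \<Longrightarrow> has_grad h c d x \<Longrightarrow> has_grad (\<lambda>x. g x * h x) (g x * c + a * h x) (g x * d + b * h x) x"
  unfolding has_grad_def by (drule (1) has_derivative_mult) (simp add: algebra_simps)

lemma has_grad_chain:
  assumes "(\<phi> has_real_derivative m) (at (g x))" "has_grad g a b x"
  shows "has_grad (\<lambda>x. \<phi> (g x)) (m * a) (m * b) x"
  using has_derivative_compose[OF assms(2)[unfolded has_grad_def] assms(1)[unfolded has_field_derivative_def]]
  unfolding has_grad_def by (simp add: algebra_simps)

lemma has_grad_square: "has_grad g a b x \<Longrightarrow> has_grad (\<lambda>x. (g x)\<^sup>2) (2 * g x * a) (2 * g x * b) x"
  using has_grad_mult[of g a b x g a b] by (simp add: power2_eq_square mult_ac)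

lemma has_grad_continuous: "(\<And>x. has_grad g (a x) (b x) x) \<Longrightarrow> continuous_on UNIV g"
  unfolding has_grad_def by (meson continuous_at_imp_continuous_on has_derivative_continuous)

lemma integral_divergence_zero:
  assumes X: "\<And>x. has_grad X (X1 x) (X2 x) x" and Y: "\<And>x. has_grad Y (Y1 x) (Y2 x) x"
    and c: "continuous_on UNIV X1" "continuous_on UNIV Y2"
    and s: "\<And>x. norm x > R \<Longrightarrow> X x = 0" "\<And>x. norm x > R \<Longrightarrow> Y x = 0"
  shows "integrable lborel (\<lambda>x. X1 x + Y2 x)" "(\<integral>x. X1 x + Y2 x \<partial>lborel) = 0"
proof -
  have X1: "X1 x = 0" if "norm x > R" for x
    using has_derivative_vanishing_outside[OF X[unfolded has_grad_def] s(1) that, of "axis 1 1"]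
    by (simp add: axis_def)
  have Y2: "Y2 x = 0" if "norm x > R" for x
    using has_derivative_vanishing_outside[OF Y[unfolded has_grad_def] s(2) that, of "axis 2 1"]
    by (simp add: axis_def)
  have i: "integrable lborel X1" "integrable lborel Y2"
    using integrable_compact_support[OF c(1) X1] integrable_compact_support[OF c(2) Y2] by auto
  then show "integrable lborel (\<lambda>x. X1 x + Y2 x)" by simp
  have "(\<integral>x. X1 x \<partial>lborel) = 0" "(\<integral>x. Y2 x \<partial>lborel) = 0"
    using integral_directional_derivative_zero[OF X[unfolded has_grad_def], of "axis 1 1" R]
      integral_directional_derivative_zero[OF Y[unfolded has_grad_def], of "axis 2 1" R] c s
    by (simp_all add: axis_def)
  then show "(\<integral>x. X1 x + Y2 x \<partial>lborel) = 0" using i by simp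
qed

text \<open>
  The Jacobian determinant of two functions is a null Lagrangian. With \<open>B\<close> a component of a
  divergence-free field, this is the weak form of the differentiated equation.
\<close>

lemma integral_jacobian_zero:
  assumes B: "\<And>x. has_grad B (B1 x) (B2 x) x" and \<eta>: "\<And>x. has_grad \<eta> (e1 x) (e2 x) x"
    and c: "continuous_on UNIV B1" "continuous_on UNIV B2" "continuous_on UNIV e1" "continuous_on UNIV e2"
    and s: "\<And>x. norm x > R \<Longrightarrow> \<eta> x = 0"
  shows "integrable lborel (\<lambda>x. B1 x * e2 x - B2 x * e1 x)" "(\<integral>x. B1 x * e2 x - B2 x * e1 x \<partial>lborel) = 0"
proof -
  have e: "e1 x = 0" "e2 x = 0" if "norm x > R" for x
    using has_derivative_vanishing_outside[OF \<eta>[unfolded has_grad_def] s that, of "axis 1 1"]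
      has_derivative_vanishing_outside[OF \<eta>[unfolded has_grad_def] s that, of "axis 2 1"]
    by (simp_all add: axis_def)
  have i: "integrable lborel (\<lambda>x. B1 x * e2 x)" "integrable lborel (\<lambda>x. B2 x * e1 x)"
    by (auto intro!: integrable_compact_support[of _ R] continuous_intros c simp: e)
  then show "integrable lborel (\<lambda>x. B1 x * e2 x - B2 x * e1 x)" by simp
  have "(\<integral>x. B1 x * e2 x \<partial>lborel) = (\<integral>x. B2 x * e1 x \<partial>lborel)"
    using integral_derivative_swap[OF B[unfolded has_grad_def] \<eta>[unfolded has_grad_def] _ _ s, where v = "axis 1 1" and w = "axis 2 1"]
      c by (simp add: axis_def continuous_intros)
  then show "(\<integral>x. B1 x * e2 x - B2 x * e1 x \<partial>lborel) = 0" using i by simp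
qed

text \<open>
  The square makes the cutoff continuously differentiable where it reaches zero.
\<close>

definition ramp_sq :: "real \<Rightarrow> real" where "ramp_sq y = (max 0 (1 - y))\<^sup>2"

lemma ramp_sq_has_derivative: "(ramp_sq has_real_derivative - 2 * max 0 (1 - y)) (at y)"
proof -
  have q: "((\<lambda>z :: real. (max 0 z)\<^sup>2) has_real_derivative 2 * max 0 z) (at z)" for z
  proof (cases "z = 0")
    case True
    have "((\<lambda>h :: real. (max 0 h)\<^sup>2 / h) \<longlongrightarrow> 0) (at 0)"
    proof (rule Lim_null_comparison)
      show "\<forall>\<^sub>F h in at 0. norm ((max 0 h)\<^sup>2 / h) \<le> \<bar>h :: real\<bar>"
        by (rule always_eventually) (auto simp: max_def power2_eq_square)
      show "((\<lambda>h :: real. \<bar>h\<bar>) \<longlongrightarrow> 0) (at 0)" by (auto intro!: tendsto_eq_intros)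
    qed
    then show ?thesis using True by (simp add: has_field_derivative_iff)
  next
    case False
    show ?thesis
    proof (cases "z > 0")
      case True
      have "((\<lambda>z :: real. z\<^sup>2) has_real_derivative 2 * z) (at z)" by (auto intro!: derivative_eq_intros)
      then have "((\<lambda>z :: real. (max 0 z)\<^sup>2) has_real_derivative 2 * z) (at z)"
        by (rule has_field_derivative_transform_within_open[of _ _ _ "{0<..}"]) (use True in auto)
      then show ?thesis using True by simp
    next
      case neg: False
      have "((\<lambda>z :: real. 0) has_real_derivative 0) (at z)" by simp
      then have "((\<lambda>z :: real. (max 0 z)\<^sup>2) has_real_derivative 0) (at z)"
        by (rule has_field_derivative_transform_within_open[of _ _ _ "{..<0}"]) (use neg False in auto)
      then show ?thesis using neg by simp
    qed
  qed
  have "((\<lambda>y. 1 - y) has_real_derivative - 1) (at y)" by (auto intro!: derivative_eq_intros)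
  from DERIV_chain2[OF q this] show ?thesis unfolding ramp_sq_def by simp
qed

text \<open>
  A staircase with ratio \<open>e\<close> that dominates \<open>1 / (1 + |x|\<^sup>2)\<close> up to radius about
  \<open>exp N\<close>. Each step has the same integral, so the total grows linearly in \<open>N\<close>, as the
  logarithm of the radius does.
\<close>

definition log_majorant :: "nat \<Rightarrow> real ^ 2 \<Rightarrow> real" where
  "log_majorant N x = (\<Sum>j<N. exp (- 2 * real j) * indicator (ball 0 (exp (real j + 1))) x)"

lemma log_majorant_nonneg: "0 \<le> log_majorant N x"
  unfolding log_majorant_def by (intro sum_nonneg) auto

lemma log_majorant_integral:
  "integrable lborel (log_majorant N)" "(\<integral>x. log_majorant N x \<partial>lborel) = exp 2 * pi * real N"
proof -
  have i: "integrable lborel (\<lambda>x :: real ^ 2. exp (- 2 * real j) * indicator (ball 0 (exp (real j + 1))) x)" for j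
    by (intro integrable_mult_right)
       (use emeasure_bounded_finite[OF bounded_ball[of "0 :: real ^ 2" "exp (real j + 1)"]] in \<open>auto simp: integrable_indicator_iff\<close>)
  show "integrable lborel (log_majorant N)"
    unfolding log_majorant_def[abs_def] by (intro Bochner_Integration.integrable_sum i)
  have "(\<integral>x. log_majorant N x \<partial>lborel)
    = (\<Sum>j<N. \<integral>x. exp (- 2 * real j) * indicator (ball 0 (exp (real j + 1))) (x :: real ^ 2) \<partial>lborel)"
    unfolding log_majorant_def by (intro Bochner_Integration.integral_sum i)
  also have "\<dots> = (\<Sum>j<N. exp 2 * pi)"
  proof (rule sum.cong)
    fix j
    have "(\<integral>x. exp (- 2 * real j) * indicator (ball 0 (exp (real j + 1))) (x :: real ^ 2) \<partial>lborel)
      = exp (- 2 * real j) * ((exp (real j + 1))\<^sup>2 * pi)"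
      using circle_area[of "exp (real j + 1)" "0 :: real ^ 2"] by simp
    also have "\<dots> = exp (- 2 * real j + (2 * (real j + 1))) * pi"
      unfolding exp_add by (simp add: power2_eq_square flip: exp_add)
    also have "\<dots> = exp 2 * pi" by simp
    finally show "(\<integral>x. exp (- 2 * real j) * indicator (ball 0 (exp (real j + 1))) (x :: real ^ 2) \<partial>lborel) = exp 2 * pi" .
  qed simp
  finally show "(\<integral>x. log_majorant N x \<partial>lborel) = exp 2 * pi * real N" by simp
qed

lemma log_majorant_ge:
  assumes s: "s = 1 + (x $ 1)\<^sup>2 + (x $ 2)\<^sup>2" and N: "ln s < 2 * real N"
  shows "1 / s \<le> log_majorant N x"
proof -
  have s1: "s \<ge> 1" by (simp add: s)
  define j where "j = nat \<lfloor>ln s / 2\<rfloor>"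
  have "ln s \<ge> 0" using s1 by simp
  then have j: "real j \<le> ln s / 2" "ln s / 2 < real j + 1" unfolding j_def by linarith+
  then have "real j < real N" using N by linarith
  then have jN: "j < N" by simp
  have "(norm x)\<^sup>2 < s" by (simp add: norm_real2_sq s)
  also have "s = exp (ln s)" using s1 by simp
  also have "\<dots> \<le> exp (2 * (real j + 1))" using j by simp
  also have "\<dots> = (exp (real j + 1))\<^sup>2" by (simp add: power2_eq_square flip: exp_add)
  finally have ball: "x \<in> ball 0 (exp (real j + 1))" by (simp add: power2_less_imp_less)
  have "1 / s = exp (- ln s)" using s1 by (simp add: exp_minus inverse_eq_divide)
  also have "\<dots> \<le> exp (- 2 * real j) * indicator (ball 0 (exp (real j + 1))) x"
    using j ball by simp
  also have "\<dots> \<le> log_majorant N x"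
    unfolding log_majorant_def using jN by (intro member_le_sum) auto
  finally show ?thesis .
qed

text \<open>
  Both mixed derivatives have the same integral against every test function: integrate by parts once
  more in \<open>integral_jacobian_zero\<close>. If they differed at \<open>y\<close>, a bump function supported where the
  difference keeps its sign would contradict this.
\<close>

lemma mixed_partials_commute:
  assumes g: "\<And>x. has_grad g (g1 x) (g2 x) x"
    and g1: "\<And>x. has_grad g1 (g11 x) (g12 x) x" and g2: "\<And>x. has_grad g2 (g21 x) (g22 x) x"
    and c: "continuous_on UNIV g12" "continuous_on UNIV g21"
  shows "g12 y = g21 y"
proof (rule ccontr)
  assume ne: "g12 y \<noteq> g21 y"
  define s where "s = (\<lambda>x. (g12 y - g21 y) * (g12 x - g21 x))"
  have cs: "continuous_on UNIV s" unfolding s_def by (intro continuous_intros c)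
  have "open {x. 0 < s x}" by (intro open_Collect_less continuous_intros cs)
  moreover have "y \<in> {x. 0 < s x}" using ne by (simp add: s_def flip: power2_eq_square)
  ultimately obtain r where r: "r > 0" "ball y r \<subseteq> {x. 0 < s x}" by (meson openE)
  define a where "a = (\<lambda>x :: real ^ 2. ((x $ 1 + - y $ 1)\<^sup>2 + (x $ 2 + - y $ 2)\<^sup>2) * (1 / r\<^sup>2))"
  define \<eta> where "\<eta> = (\<lambda>x. ramp_sq (a x))"
  define e1 where "e1 = (\<lambda>x. - 2 * max 0 (1 - a x) * (2 * (x $ 1 + - y $ 1) / r\<^sup>2))"
  define e2 where "e2 = (\<lambda>x. - 2 * max 0 (1 - a x) * (2 * (x $ 2 + - y $ 2) / r\<^sup>2))"
  have a: "has_grad a (2 * (x $ 1 + - y $ 1) / r\<^sup>2) (2 * (x $ 2 + - y $ 2) / r\<^sup>2) x" for x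
    unfolding a_def
    by (rule has_grad_eq[OF has_grad_mult[OF has_grad_add[OF has_grad_square[OF has_grad_add[OF has_grad_coord(1) has_grad_const]]
       has_grad_square[OF has_grad_add[OF has_grad_coord(2) has_grad_const]]] has_grad_const]]) auto
  have e: "has_grad \<eta> (e1 x) (e2 x) x" for x
    unfolding \<eta>_def e1_def e2_def by (rule has_grad_chain[OF ramp_sq_has_derivative a])
  have ca: "continuous_on UNIV a" using a by (rule has_grad_continuous)
  have ce: "continuous_on UNIV e1" "continuous_on UNIV e2" "continuous_on UNIV \<eta>"
    using r e by (auto simp: e1_def e2_def intro!: continuous_intros ca has_grad_continuous[of \<eta>])
  have far: "\<eta> x = 0" if "dist y x \<ge> r" for x
  proof -
    have "r\<^sup>2 \<le> (dist y x)\<^sup>2" using that r by (intro power_mono) auto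
    also have "(dist y x)\<^sup>2 = (x $ 1 + - y $ 1)\<^sup>2 + (x $ 2 + - y $ 2)\<^sup>2"
      unfolding dist_norm norm_real2_sq by (simp add: power2_commute[of "y $ 1"] power2_commute[of "y $ 2"])
    finally have "1 \<le> a x" using r by (simp add: a_def)
    then show ?thesis by (simp add: \<eta>_def ramp_sq_def)
  qed
  have supp: "\<eta> x = 0" if "norm x > norm y + r" for x
    using that norm_triangle_ineq2[of x y] by (intro far) (simp add: dist_norm norm_minus_commute)
  have cg: "continuous_on UNIV g1" "continuous_on UNIV g2"
    using g1 g2 by (blast intro: has_grad_continuous)+
  have J: "integrable lborel (\<lambda>x. g1 x * e2 x - g2 x * e1 x)" "(\<integral>x. g1 x * e2 x - g2 x * e1 x \<partial>lborel) = 0"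
    using integral_jacobian_zero[OF g e cg ce(1,2) supp] by auto
  have Y: "has_grad (\<lambda>x. - 1 * (g1 x * \<eta> x)) (- (g1 x * e1 x + g11 x * \<eta> x)) (- (g1 x * e2 x + g12 x * \<eta> x)) x" for x
    by (rule has_grad_eq[OF has_grad_mult[OF has_grad_const has_grad_mult[OF g1 e]]]) auto
  have "continuous_on UNIV (\<lambda>x. g2 x * e1 x + g21 x * \<eta> x)" "continuous_on UNIV (\<lambda>x. - (g1 x * e2 x + g12 x * \<eta> x))"
    by (intro continuous_intros cg ce c)+
  note D = integral_divergence_zero[OF has_grad_mult[OF g2 e] Y this, of "norm y + r"]
  have D: "integrable lborel (\<lambda>x. g2 x * e1 x + g21 x * \<eta> x + - (g1 x * e2 x + g12 x * \<eta> x))"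
    "(\<integral>x. g2 x * e1 x + g21 x * \<eta> x + - (g1 x * e2 x + g12 x * \<eta> x) \<partial>lborel) = 0"
    by (rule D; simp add: supp)+
  have S: "s x * \<eta> x = - (g12 y - g21 y) * ((g1 x * e2 x - g2 x * e1 x)
      + (g2 x * e1 x + g21 x * \<eta> x + - (g1 x * e2 x + g12 x * \<eta> x)))" for x
    by (simp add: s_def algebra_simps)
  have "integrable lborel (\<lambda>x. s x * \<eta> x)" "(\<integral>x. s x * \<eta> x \<partial>lborel) = 0"
    unfolding S
    by (intro integrable_mult_right Bochner_Integration.integrable_add J D)
       (simp only: integral_mult_right_zero Bochner_Integration.integral_add[OF J(1) D(1)] J(2) D(2) add_0_right mult_zero_right)
  moreover have "0 \<le> s x * \<eta> x" for x
  proof (cases "dist y x < r")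
    case True
    then have "0 < s x" using r(2) by auto
    then show ?thesis by (simp add: \<eta>_def ramp_sq_def)
  qed (simp add: far)
  moreover have "continuous_on UNIV (\<lambda>x. s x * \<eta> x)" by (intro continuous_intros cs ce)
  ultimately have "s y * \<eta> y = 0" using continuous_nonneg_integral_zero[of "\<lambda>x. s x * \<eta> x"] by blast
  moreover have "\<eta> y = 1" by (simp add: \<eta>_def a_def ramp_sq_def)
  ultimately show False using ne by (simp add: s_def)
qed

section \<open>Logarithmic area growth of entire graphs\<close>

lemma abs_arctan_le_2: "\<bar>arctan y\<bar> \<le> 2"
  using arctan_lbound[of y] arctan_ubound[of y] pi_less_4 by auto

lemma log_cutoff_vanishes:
  assumes s: "s \<ge> 1 + (x $ 1)\<^sup>2 + (x $ 2)\<^sup>2" and N: "norm (x :: real ^ 2) > exp c"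
  shows "ln s \<ge> 2 * c"
proof -
  have "exp (2 * c) = (exp c)\<^sup>2" by (simp add: power2_eq_square flip: exp_add)
  also have "\<dots> \<le> (norm x)\<^sup>2" using N by (intro power_mono) auto
  also have "\<dots> \<le> s" using s by (simp add: norm_real2_sq)
  finally have "ln (exp (2 * c)) \<le> ln s" by (intro ln_mono) (auto intro: less_le_trans[OF exp_gt_zero])
  then show ?thesis by simp
qed

text \<open>
  The data of a \<open>C\<^sup>2\<close> solution on the whole plane: \<open>p\<close> and \<open>q\<close> are the first derivatives of
  \<open>f\<close>, and \<open>p1\<close>, \<open>p2\<close>, \<open>q2\<close> the second ones, with symmetry built in.
\<close>

locale entire_solution =
  fixes k :: real and f p q p1 p2 q2 :: "real ^ 2 \<Rightarrow> real"
  assumes k: "0 \<le> k" "k < 1 / 9"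
    and grad_f: "\<And>x. has_grad f (p x) (q x) x"
    and grad_p: "\<And>x. has_grad p (p1 x) (p2 x) x"
    and grad_q: "\<And>x. has_grad q (p2 x) (q2 x) x"
    and cont2: "continuous_on UNIV p1" "continuous_on UNIV p2" "continuous_on UNIV q2"
    and equation: "\<And>x. kappa k (1 + (p x)\<^sup>2 + (q x)\<^sup>2) * (p1 x + q2 x)
      + mu k (1 + (p x)\<^sup>2 + (q x)\<^sup>2) * ((p x)\<^sup>2 * p1 x + 2 * p x * q x * p2 x + (q x)\<^sup>2 * q2 x) = 0"
begin

definition slope :: "real ^ 2 \<Rightarrow> real" where "slope x = 1 + (p x)\<^sup>2 + (q x)\<^sup>2"
text \<open>
  One plus the squared distance from the origin, measured in the plane and at the corresponding
  point of the graph. The summand one keeps the logarithms nonnegative and the quotients regular.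
\<close>

definition planar_sq :: "real ^ 2 \<Rightarrow> real" where "planar_sq x = 1 + (x $ 1)\<^sup>2 + (x $ 2)\<^sup>2"
definition space_sq :: "real ^ 2 \<Rightarrow> real" where "space_sq x = planar_sq x + (f x)\<^sup>2"

text \<open>
  The pairs \<open>(A1, A2)\<close> and \<open>(B1, B2)\<close> are the gradients of the two components \<open>K p\<close> and
  \<open>K q\<close> of the divergence-free field.
\<close>

definition A1 where "A1 x = elliptic_form k (p x) (q x) (p1 x) (p2 x) 1 0"
definition A2 where "A2 x = elliptic_form k (p x) (q x) (p2 x) (q2 x) 1 0"
definition B1 where "B1 x = elliptic_form k (p x) (q x) (p1 x) (p2 x) 0 1"
definition B2 where "B2 x = elliptic_form k (p x) (q x) (p2 x) (q2 x) 0 1"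
definition K where "K x = kappa k (slope x)"
definition hessian_energy where "hessian_energy x = elliptic_form k (p x) (q x) (p1 x) (p2 x) (p1 x) (p2 x)"

lemma slope_ge: "1 \<le> slope x" by (simp add: slope_def)
lemma planar_sq_ge: "1 \<le> planar_sq x" by (simp add: planar_sq_def)
lemma space_sq_ge: "1 \<le> space_sq x" "planar_sq x \<le> space_sq x" "(f x)\<^sup>2 \<le> space_sq x"
  using planar_sq_ge[of x] by (auto simp: space_sq_def intro: add_increasing2)

lemma cont1: "continuous_on UNIV f" "continuous_on UNIV p" "continuous_on UNIV q"
  using grad_f grad_p grad_q by (blast intro: has_grad_continuous)+

lemma cont_aux: "continuous_on UNIV slope" "continuous_on UNIV planar_sq" "continuous_on UNIV space_sq"
  unfolding slope_def[abs_def] planar_sq_def[abs_def] space_sq_def[abs_def]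
  by (intro continuous_intros cont1)+

lemma cont_kappa: "continuous_on UNIV (\<lambda>x. kappa k (slope x))"
proof (rule continuous_on_compose2[of "{1..}" "kappa k"])
  show "continuous_on {1..} (kappa k)"
  proof (intro continuous_at_imp_continuous_on ballI)
    fix t :: real assume "t \<in> {1..}"
    then have "t > 0" "t \<noteq> k" using k by auto
    then show "isCont (kappa k) t" by (rule DERIV_isCont[OF kappa_has_derivative])
  qed
qed (use cont_aux slope_ge in auto)

lemma cont_mu: "continuous_on UNIV (\<lambda>x. mu k (slope x))"
  unfolding mu_def
proof (intro continuous_intros cont_aux ballI)
  fix x show "sqrt (slope x) * (slope x - k) ^ 3 \<noteq> 0" using slope_ge[of x] k by auto
qed

lemma cont_elliptic_form:
  assumes "continuous_on UNIV a1" "continuous_on UNIV a2" "continuous_on UNIV b1" "continuous_on UNIV b2"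
  shows "continuous_on UNIV (\<lambda>x. elliptic_form k (p x) (q x) (a1 x) (a2 x) (b1 x) (b2 x))"
  unfolding elliptic_form_def slope_def[symmetric] by (intro continuous_intros cont_kappa cont_mu cont1 assms)

lemma cont_AB: "continuous_on UNIV A1" "continuous_on UNIV A2" "continuous_on UNIV B1" "continuous_on UNIV B2"
  "continuous_on UNIV hessian_energy" "continuous_on UNIV K"
  unfolding A1_def[abs_def] A2_def[abs_def] B1_def[abs_def] B2_def[abs_def] hessian_energy_def[abs_def] K_def[abs_def]
  by (intro cont_elliptic_form cont_kappa cont2 continuous_intros)+

lemma K_pos: "0 < K x"
proof -
  have "0 < sqrt (slope x) * K x" using kappa_bounds(1)[OF k slope_ge[of x]] by (simp add: K_def)
  moreover have "0 < sqrt (slope x)" using slope_ge[of x] by simp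
  ultimately show ?thesis by (simp add: zero_less_mult_iff)
qed

lemma grad_K: "has_grad K (mu k (slope x) * (p x * p1 x + q x * p2 x)) (mu k (slope x) * (p x * p2 x + q x * q2 x)) x"
proof -
  have "has_grad slope (0 + 2 * p x * p1 x + 2 * q x * p2 x) (0 + 2 * p x * p2 x + 2 * q x * q2 x) x"
    unfolding slope_def[abs_def] by (intro has_grad_add has_grad_const has_grad_square grad_p grad_q)
  moreover have "(kappa k has_real_derivative mu k (slope x) / 2) (at (slope x))"
    using slope_ge[of x] k by (intro kappa_has_derivative) auto
  ultimately have "has_grad (\<lambda>x. kappa k (slope x))
      (mu k (slope x) / 2 * (0 + 2 * p x * p1 x + 2 * q x * p2 x)) (mu k (slope x) / 2 * (0 + 2 * p x * p2 x + 2 * q x * q2 x)) x"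
    by (rule has_grad_chain[rotated])
  then show ?thesis unfolding K_def[abs_def]
    by (rule has_grad_eq) (simp_all add: algebra_simps)
qed

lemma grad_A: "has_grad (\<lambda>x. K x * p x) (A1 x) (A2 x) x"
  by (rule has_grad_eq[OF has_grad_mult[OF grad_K grad_p]])
     (simp_all add: A1_def A2_def elliptic_form_def K_def slope_def algebra_simps)

lemma grad_B: "has_grad (\<lambda>x. K x * q x) (B1 x) (B2 x) x"
  by (rule has_grad_eq[OF has_grad_mult[OF grad_K grad_q]])
     (simp_all add: B1_def B2_def elliptic_form_def K_def slope_def algebra_simps)

lemma divergence_free: "A1 x + B2 x = 0"
  using equation[of x] by (simp add: A1_def B2_def elliptic_form_def power2_eq_square algebra_simps)

lemma grad_planar_sq: "has_grad planar_sq (2 * x $ 1) (2 * x $ 2) x"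
  unfolding planar_sq_def[abs_def]
  by (rule has_grad_eq[OF has_grad_add[OF has_grad_add[OF has_grad_const has_grad_square[OF has_grad_coord(1)]]
        has_grad_square[OF has_grad_coord(2)]]]) auto

lemma grad_space_sq: "has_grad space_sq (2 * (x $ 1 + f x * p x)) (2 * (x $ 2 + f x * q x)) x"
  unfolding space_sq_def[abs_def]
  by (rule has_grad_eq[OF has_grad_add[OF grad_planar_sq has_grad_square[OF grad_f]]]) auto

text \<open>
  The square of the cutoff that decreases linearly in the logarithm of the planar radius and vanishes
  from radius about \<open>exp N\<close> on.
\<close>

definition planar_weight where "planar_weight N x = ramp_sq (ln (planar_sq x) / (2 * real N))"
definition planar_cutoff where "planar_cutoff N x = max 0 (1 - ln (planar_sq x) / (2 * real N))"

lemma grad_planar_weight: "N > 0 \<Longrightarrow> has_grad (planar_weight N) (- 2 * planar_cutoff N x * x $ 1 / (real N * planar_sq x)) (- 2 * planar_cutoff N x * x $ 2 / (real N * planar_sq x)) x"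
proof -
  assume N: "N > 0"
  have b: "planar_sq x > 0" using planar_sq_ge[of x] by simp
  have "((\<lambda>s. ln s / (2 * real N)) has_real_derivative 1 / planar_sq x / (2 * real N)) (at (planar_sq x))"
    using b N by (auto intro!: derivative_eq_intros)
  from has_grad_chain[OF ramp_sq_has_derivative has_grad_chain[OF this grad_planar_sq]]
  show ?thesis unfolding planar_weight_def[abs_def] planar_cutoff_def
    by (rule has_grad_eq) (use N b in \<open>simp_all add: field_simps\<close>)
qed

lemma planar_cutoff_bounds: "0 \<le> planar_cutoff N x" "planar_cutoff N x \<le> 1" "planar_weight N x = (planar_cutoff N x)\<^sup>2"
proof -
  have "ln (planar_sq x) \<ge> 0" using planar_sq_ge[of x] by simp
  then show "0 \<le> planar_cutoff N x" "planar_cutoff N x \<le> 1" "planar_weight N x = (planar_cutoff N x)\<^sup>2" by (auto simp: planar_cutoff_def planar_weight_def ramp_sq_def)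
qed

lemma planar_cutoff_support:
  assumes "N > 0" "norm x > exp (real N)" shows "planar_cutoff N x = 0"
proof -
  have "2 * real N \<le> ln (planar_sq x)" using assms by (intro log_cutoff_vanishes) (auto simp: planar_sq_def)
  then show ?thesis using assms by (simp add: planar_cutoff_def)
qed

lemma planar_cutoff_majorant: "N > 0 \<Longrightarrow> planar_cutoff N x / planar_sq x \<le> log_majorant N x"
proof (cases "planar_cutoff N x = 0")
  case False
  assume N: "N > 0"
  then have "ln (planar_sq x) < 2 * real N" using False by (auto simp: planar_cutoff_def max_def divide_less_eq split: if_splits)
  then have "1 / planar_sq x \<le> log_majorant N x" by (intro log_majorant_ge) (auto simp: planar_sq_def)
  moreover have "planar_cutoff N x / planar_sq x \<le> 1 / planar_sq x" using planar_cutoff_bounds[of N x] planar_sq_ge[of x] by (intro divide_right_mono) auto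
  ultimately show ?thesis by linarith
qed (simp add: log_majorant_nonneg)

lemma cont_planar_cutoff: "N > 0 \<Longrightarrow> continuous_on UNIV (planar_cutoff N)" "N > 0 \<Longrightarrow> continuous_on UNIV (planar_weight N)"
  unfolding planar_cutoff_bounds(3)[abs_def] unfolding planar_cutoff_def[abs_def]
  using planar_sq_ge by (auto intro!: continuous_intros cont_aux simp: less_le_trans[OF zero_less_one] dual_order.strict_implies_not_eq)

text \<open>
  The factor in front of the weight is the integral of \<open>1 / (R\<^sup>2 + z\<^sup>2)\<close> over heights \<open>z\<close>
  from zero to \<open>f\<close>, where \<open>R\<^sup>2\<close> is \<open>planar_sq\<close>. Its derivative in the height is the
  weight \<open>1 / space_sq\<close> wanted in the area estimate, while its planar derivatives are of order
  \<open>1 / R\<^sup>2\<close> at every height; together with the derivative of the weight they are \<open>- x\<close> times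
  \<open>defect\<close>.
\<close>

definition area_test where "area_test N x = arctan (f x / sqrt (planar_sq x)) / sqrt (planar_sq x) * planar_weight N x"
definition defect where "defect N x = planar_weight N x * f x / (planar_sq x * space_sq x)
   + arctan (f x / sqrt (planar_sq x)) * (planar_weight N x + 2 * planar_cutoff N x / real N) / (planar_sq x * sqrt (planar_sq x))"

lemma grad_area_test:
  assumes N: "N > 0"
  shows "has_grad (area_test N) (planar_weight N x * p x / space_sq x - defect N x * x $ 1)
    (planar_weight N x * q x / space_sq x - defect N x * x $ 2) x"
proof -
  define r where "r = sqrt (planar_sq x)"
  have r: "r > 0" "planar_sq x = r * r" using planar_sq_ge[of x] by (auto simp: r_def)
  have D: "((\<lambda>s. 1 / sqrt s) has_real_derivative - 1 / (2 * (r * r * r))) (at (planar_sq x))"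
    using r by (auto intro!: derivative_eq_intros simp: r_def[symmetric] field_simps)
  have \<sigma>: "has_grad (\<lambda>x. 1 / sqrt (planar_sq x)) (- 1 / (2 * (r * r * r)) * (2 * x $ 1)) (- 1 / (2 * (r * r * r)) * (2 * x $ 2)) x"
    by (rule has_grad_chain[OF D grad_planar_sq])
  have at: "(arctan has_real_derivative inverse (1 + (f x * (1 / sqrt (planar_sq x)))\<^sup>2)) (at (f x * (1 / sqrt (planar_sq x))))"
    by (rule DERIV_arctan)
  have i: "inverse (1 + (f x * (1 / sqrt (planar_sq x)))\<^sup>2) = r * r / space_sq x"
    using r planar_sq_ge[of x] space_sq_ge[of x]
    by (simp add: space_sq_def r_def[symmetric] power_mult_distrib power_divide power2_eq_square field_simps)
  have d: "space_sq x > 0" using space_sq_ge(1)[of x] by simp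
  have area_test_eq: "area_test N = (\<lambda>x. arctan (f x * (1 / sqrt (planar_sq x))) * (1 / sqrt (planar_sq x)) * planar_weight N x)"
    by (simp add: area_test_def fun_eq_iff)
  show ?thesis
    unfolding area_test_eq
  proof (rule has_grad_eq[OF has_grad_mult[OF has_grad_mult[OF has_grad_chain[OF at has_grad_mult[OF grad_f \<sigma>]] \<sigma>] grad_planar_weight[OF N]]])
    have "arctan (f x * (1 / r)) * (1 / r) * (- 2 * c * X / (real N * (r * r)))
        + (arctan (f x * (1 / r)) * (- 1 / (2 * (r * r * r)) * (2 * X))
          + r * r / d * (f x * (- 1 / (2 * (r * r * r)) * (2 * X)) + P * (1 / r)) * (1 / r)) * m
      = m * P / d - (m * f x / (r * r * d) + arctan (f x / r) * (m + 2 * c / real N) / (r * r * r)) * X"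
      if "d > 0" for X P c m d
    proof -
      have h1: "r * r / d * (f x * (- 1 / (2 * (r * r * r)) * (2 * X)) + P * (1 / r)) * (1 / r) = P / d - f x * X / (r * r * d)"
        using r(1) that by (simp add: field_simps)
      have h2: "f x * (1 / r) = f x / r" by simp
      have h0: "- 1 / (2 * (r * r * r)) * (2 * X) = - (X / (r * r * r))" by simp
      show ?thesis unfolding h1 unfolding h0 h2
        by (simp add: ring_distribs add_divide_distrib diff_divide_distrib mult_ac)
    qed
    note eq = this[OF d]
    show "arctan (f x * (1 / sqrt (planar_sq x))) * (1 / sqrt (planar_sq x)) * (- 2 * planar_cutoff N x * x $ 1 / (real N * planar_sq x))
      + (arctan (f x * (1 / sqrt (planar_sq x))) * (- 1 / (2 * (r * r * r)) * (2 * x $ 1))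
        + inverse (1 + (f x * (1 / sqrt (planar_sq x)))\<^sup>2) * (f x * (- 1 / (2 * (r * r * r)) * (2 * x $ 1)) + p x * (1 / sqrt (planar_sq x))) * (1 / sqrt (planar_sq x))) * planar_weight N x
      = planar_weight N x * p x / space_sq x - defect N x * x $ 1"
      unfolding i defect_def unfolding r_def[symmetric] unfolding r(2) by (rule eq)
    show "arctan (f x * (1 / sqrt (planar_sq x))) * (1 / sqrt (planar_sq x)) * (- 2 * planar_cutoff N x * x $ 2 / (real N * planar_sq x))
      + (arctan (f x * (1 / sqrt (planar_sq x))) * (- 1 / (2 * (r * r * r)) * (2 * x $ 2))
        + inverse (1 + (f x * (1 / sqrt (planar_sq x)))\<^sup>2) * (f x * (- 1 / (2 * (r * r * r)) * (2 * x $ 2)) + q x * (1 / sqrt (planar_sq x))) * (1 / sqrt (planar_sq x))) * planar_weight N x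
      = planar_weight N x * q x / space_sq x - defect N x * x $ 2"
      unfolding i defect_def unfolding r_def[symmetric] unfolding r(2) by (rule eq)
  qed
qed

text \<open>
  By the Cauchy-Schwarz inequality, since \<open>K\<close> times the square root of the slope is at most one.
\<close>

lemma flux_bound:
  fixes y :: "real ^ 2"
  shows "K x * \<bar>p x * y $ 1 + q x * y $ 2\<bar> \<le> norm y"
proof -
  have le: "\<bar>p x * y $ 1 + q x * y $ 2\<bar>\<^sup>2 \<le> slope x * (norm y)\<^sup>2"
  proof -
    have "(p x * y $ 1 + q x * y $ 2)\<^sup>2 + (p x * y $ 2 - q x * y $ 1)\<^sup>2 + (norm y)\<^sup>2 = slope x * (norm y)\<^sup>2"
      unfolding norm_real2_sq slope_def by (simp add: power2_eq_square algebra_simps)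
    then show ?thesis unfolding power2_abs
      using zero_le_power2[of "p x * y $ 2 - q x * y $ 1"] zero_le_power2[of "norm y"] by linarith
  qed
  have "\<bar>p x * y $ 1 + q x * y $ 2\<bar> \<le> sqrt (slope x) * norm y"
  proof (rule power2_le_imp_le[rotated])
    show "0 \<le> sqrt (slope x) * norm y" using slope_ge[of x] by simp
    have "(sqrt (slope x) * norm y)\<^sup>2 = slope x * (norm y)\<^sup>2"
      using slope_ge[of x] by (simp add: power_mult_distrib)
    then show "\<bar>p x * y $ 1 + q x * y $ 2\<bar>\<^sup>2 \<le> (sqrt (slope x) * norm y)\<^sup>2"
      using le by (simp only:)
  qed
  then have "K x * \<bar>p x * y $ 1 + q x * y $ 2\<bar> \<le> K x * (sqrt (slope x) * norm y)"
    using K_pos[of x] by (intro mult_left_mono) auto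
  also have "\<dots> = (sqrt (slope x) * K x) * norm y" by simp
  also have "\<dots> \<le> 1 * norm y"
    using kappa_bounds(2)[OF k slope_ge[of x]] by (intro mult_right_mono) (auto simp: K_def)
  finally show ?thesis by simp
qed

lemma defect_bound:
  assumes N: "N > 0"
  shows "\<bar>defect N x\<bar> * norm x \<le> 7 * (planar_cutoff N x / planar_sq x)"
proof -
  define r where "r = sqrt (planar_sq x)"
  have r: "r > 0" "planar_sq x = r * r" using planar_sq_ge[of x] by (auto simp: r_def)
  have nr: "norm x \<le> r" unfolding r_def by (intro real_le_rsqrt) (simp add: planar_sq_def norm_real2_sq)
  have c: "0 \<le> planar_cutoff N x" "planar_cutoff N x \<le> 1" "0 \<le> planar_weight N x" "planar_weight N x \<le> planar_cutoff N x"
    using planar_cutoff_bounds[of N x] by (auto simp: power2_eq_square mult_left_le)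
  have d: "space_sq x > 0" using space_sq_ge(1)[of x] by simp
  have fr: "\<bar>f x\<bar> * r \<le> space_sq x"
  proof -
    have "0 \<le> (\<bar>f x\<bar> - r)\<^sup>2" by simp
    then have "2 * (\<bar>f x\<bar> * r) \<le> space_sq x" by (simp add: space_sq_def r(2) power2_eq_square algebra_simps)
    then show ?thesis using d by linarith
  qed
  have "\<bar>planar_weight N x * f x / (planar_sq x * space_sq x)\<bar> * r = planar_weight N x / planar_sq x * (\<bar>f x\<bar> * r / space_sq x)"
    using c r d by (simp add: abs_mult)
  also have "\<dots> \<le> planar_weight N x / planar_sq x * 1"
    using fr d c r by (intro mult_left_mono) auto
  also have "\<dots> \<le> planar_cutoff N x / planar_sq x" using c r by (simp add: divide_right_mono)
  finally have 1: "\<bar>planar_weight N x * f x / (planar_sq x * space_sq x)\<bar> * r \<le> planar_cutoff N x / planar_sq x" .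
  have N1: "2 * planar_cutoff N x / real N \<le> 2 * planar_cutoff N x"
  proof -
    have "2 * planar_cutoff N x / real N \<le> 2 * planar_cutoff N x / 1" using N c by (intro divide_left_mono) auto
    then show ?thesis by simp
  qed
  have "\<bar>arctan (f x / sqrt (planar_sq x)) * (planar_weight N x + 2 * planar_cutoff N x / real N) / (planar_sq x * sqrt (planar_sq x))\<bar> * r
    = \<bar>arctan (f x / r)\<bar> * (planar_weight N x + 2 * planar_cutoff N x / real N) / planar_sq x"
    using c r N by (simp add: abs_mult r_def[symmetric])
  also have "\<dots> \<le> 2 * (3 * planar_cutoff N x) / planar_sq x"
    using abs_arctan_le_2 c N1 r N by (intro divide_right_mono mult_mono) auto
  finally have 2: "\<bar>arctan (f x / sqrt (planar_sq x)) * (planar_weight N x + 2 * planar_cutoff N x / real N) / (planar_sq x * sqrt (planar_sq x))\<bar> * r \<le> 6 * (planar_cutoff N x / planar_sq x)"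
    by simp
  have "\<bar>defect N x\<bar> * norm x \<le> \<bar>defect N x\<bar> * r" using nr by (intro mult_left_mono) auto
  also have "\<dots> \<le> (\<bar>planar_weight N x * f x / (planar_sq x * space_sq x)\<bar>
     + \<bar>arctan (f x / sqrt (planar_sq x)) * (planar_weight N x + 2 * planar_cutoff N x / real N) / (planar_sq x * sqrt (planar_sq x))\<bar>) * r"
    unfolding defect_def using r by (intro mult_right_mono abs_triangle_ineq) auto
  also have "\<dots> \<le> 7 * (planar_cutoff N x / planar_sq x)" unfolding distrib_right using 1 2 by linarith
  finally show ?thesis .
qed

text \<open>
  The product of the divergence-free field with the gradient of \<open>f\<close> controls the area element.
\<close>

lemma sqrt_slope_le: "sqrt (slope x) \<le> 1 + 3 / 2 * (K x * (slope x - 1))"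
proof -
  define r where "r = sqrt (slope x)"
  have r: "r \<ge> 1" "slope x = r * r" using slope_ge[of x] by (auto simp: r_def)
  define Z where "Z = r * K x * (r * r - 1)"
  have "2 / 3 \<le> r * K x" using kappa_bounds(1)[OF k slope_ge] by (simp add: K_def r_def)
  then have "2 / 3 * (r * r - 1) \<le> Z"
    unfolding Z_def using r by (intro mult_right_mono) (auto simp: mult_ge1_I)
  moreover have "r * (r - 1) \<le> r * r - 1" using r by (simp add: algebra_simps)
  ultimately have "r * (r - 1) \<le> 3 / 2 * Z" unfolding right_diff_distrib by linarith
  also have "\<dots> = r * (3 / 2 * (K x * (r * r - 1)))" by (simp add: Z_def)
  finally have "r * (r - 1) \<le> r * (3 / 2 * (K x * (r * r - 1)))" .
  then have "r - 1 \<le> 3 / 2 * (K x * (r * r - 1))" using r by simp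
  then have "r \<le> 1 + 3 / 2 * (K x * (slope x - 1))" unfolding r(2) by linarith
  then show ?thesis unfolding r_def .
qed

text \<open>
  The field \<open>K (p, q)\<close> is divergence free, hence orthogonal in the mean to the gradient of
  \<open>area_test\<close>. The part of that gradient proportional to \<open>(p, q)\<close> yields the weighted area by
  \<open>sqrt_slope_le\<close>; the rest is paired with a field of length at most one and is of order
  \<open>1 / R\<^sup>2\<close>, whose planar integral is logarithmic.
\<close>

theorem area_growth:
  assumes N: "N > 0"
  shows "integrable lborel (\<lambda>x. planar_weight N x * sqrt (slope x) / space_sq x)"
    "(\<integral>x. planar_weight N x * sqrt (slope x) / space_sq x \<partial>lborel) \<le> 12 * exp 2 * pi * real N"
proof -
  define T1 where "T1 = (\<lambda>x. planar_weight N x * p x / space_sq x - defect N x * x $ 1)"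
  define T2 where "T2 = (\<lambda>x. planar_weight N x * q x / space_sq x - defect N x * x $ 2)"
  have T: "has_grad (area_test N) (T1 x) (T2 x) x" for x using grad_area_test[OF N] by (simp add: T1_def T2_def)
  define I where "I = (\<lambda>x. (K x * p x * T1 x + A1 x * area_test N x) + (K x * q x * T2 x + B2 x * area_test N x))"
  have nz: "planar_sq x \<noteq> 0" "space_sq x \<noteq> 0" "sqrt (planar_sq x) \<noteq> 0" for x
    using planar_sq_ge[of x] space_sq_ge(1)[of x] by auto
  have cd: "continuous_on UNIV (defect N)"
    unfolding defect_def[abs_def] using nz N by (intro continuous_intros cont_aux cont1 cont_planar_cutoff[OF N]) auto
  have cT: "continuous_on UNIV T1" "continuous_on UNIV T2"
    unfolding T1_def T2_def using nz by (auto intro!: continuous_intros cont_aux cont1 cont_planar_cutoff[OF N] cd)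
  have cp: "continuous_on UNIV (area_test N)" using T by (rule has_grad_continuous)
  have supp: "area_test N x = 0" if "norm x > exp (real N)" for x
    using planar_cutoff_support[OF N that] by (simp add: area_test_def planar_cutoff_bounds(3))
  have gX: "has_grad (\<lambda>x. K x * p x * area_test N x) (K x * p x * T1 x + A1 x * area_test N x) (K x * p x * T2 x + A2 x * area_test N x) x" for x
    by (rule has_grad_mult[OF grad_A T])
  have gY: "has_grad (\<lambda>x. K x * q x * area_test N x) (K x * q x * T1 x + B1 x * area_test N x) (K x * q x * T2 x + B2 x * area_test N x) x" for x
    by (rule has_grad_mult[OF grad_B T])
  have "continuous_on UNIV (\<lambda>x. K x * p x * T1 x + A1 x * area_test N x)" "continuous_on UNIV (\<lambda>x. K x * q x * T2 x + B2 x * area_test N x)"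
    by (intro continuous_intros cont_AB cont1 cT cp)+
  note div = integral_divergence_zero[OF gX gY this, of "exp (real N)"]
  have I: "integrable lborel I" "(\<integral>x. I x \<partial>lborel) = 0"
    unfolding I_def by (rule div; simp add: supp)+
  have I_eq: "I x = planar_weight N x * (K x * (slope x - 1)) / space_sq x - K x * (p x * x $ 1 + q x * x $ 2) * defect N x" for x
  proof -
    have "I x = K x * (p x * T1 x + q x * T2 x) + (A1 x + B2 x) * area_test N x" by (simp add: I_def algebra_simps)
    then show ?thesis
      unfolding divergence_free T1_def T2_def slope_def
      by (simp add: power2_eq_square algebra_simps add_divide_distrib)
  qed
  show int: "integrable lborel (\<lambda>x. planar_weight N x * sqrt (slope x) / space_sq x)"
    by (rule integrable_compact_support[of _ "exp (real N)"])
       (use nz planar_cutoff_support[OF N] in \<open>auto intro!: continuous_intros cont_aux cont_planar_cutoff[OF N] simp: planar_cutoff_bounds(3)\<close>)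
  have pw: "planar_weight N x * sqrt (slope x) / space_sq x \<le> 3 / 2 * I x + 12 * log_majorant N x" for x
  proof -
    have d: "space_sq x > 0" and b: "planar_sq x > 0" using space_sq_ge(1)[of x] planar_sq_ge[of x] by auto
    have c: "0 \<le> planar_weight N x" "planar_weight N x \<le> planar_cutoff N x" "0 \<le> planar_cutoff N x"
      using planar_cutoff_bounds[of N x] by (auto simp: power2_eq_square mult_left_le)
    have h1: "planar_weight N x * sqrt (slope x) / space_sq x \<le> planar_weight N x / space_sq x + 3 / 2 * (planar_weight N x * (K x * (slope x - 1)) / space_sq x)"
    proof -
      have "planar_weight N x * sqrt (slope x) / space_sq x \<le> planar_weight N x * (1 + 3 / 2 * (K x * (slope x - 1))) / space_sq x"
        using sqrt_slope_le c d by (intro divide_right_mono mult_left_mono) auto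
      also have "\<dots> = planar_weight N x / space_sq x + 3 / 2 * (planar_weight N x * (K x * (slope x - 1)) / space_sq x)"
        by (simp only: distrib_left add_divide_distrib mult_1_right mult.left_commute[of "planar_weight N x"] times_divide_eq_right)
      finally show ?thesis .
    qed
    have h2: "planar_weight N x / space_sq x \<le> planar_cutoff N x / planar_sq x"
      using c d b space_sq_ge(2)[of x] by (intro frac_le) auto
    have h3: "planar_weight N x * (K x * (slope x - 1)) / space_sq x = I x + K x * (p x * x $ 1 + q x * x $ 2) * defect N x"
      by (simp add: I_eq)
    have h4: "K x * (p x * x $ 1 + q x * x $ 2) * defect N x \<le> 7 * (planar_cutoff N x / planar_sq x)"
    proof -
      have "K x * (p x * x $ 1 + q x * x $ 2) * defect N x \<le> \<bar>K x * (p x * x $ 1 + q x * x $ 2)\<bar> * \<bar>defect N x\<bar>"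
        by (metis abs_ge_self abs_mult)
      also have "\<dots> \<le> norm x * \<bar>defect N x\<bar>"
        using flux_bound[of x x] K_pos[of x] by (intro mult_right_mono) (auto simp: abs_mult)
      also have "\<dots> \<le> 7 * (planar_cutoff N x / planar_sq x)" using defect_bound[OF N, of x] by (simp only: mult.commute)
      finally show ?thesis .
    qed
    have "a \<le> 3 / 2 * i + 12 * l"
      if "a \<le> u + 3 / 2 * w" "u \<le> y" "w = i + z" "z \<le> 7 * y" "y \<le> l" "0 \<le> y" for a u w i z y l :: real
      using that by linarith
    from this[OF h1 h2 h3 h4 planar_cutoff_majorant[OF N] divide_nonneg_pos[OF c(3) b]]
    show ?thesis .
  qed
  have "(\<integral>x. planar_weight N x * sqrt (slope x) / space_sq x \<partial>lborel) \<le> (\<integral>x. 3 / 2 * I x + 12 * log_majorant N x \<partial>lborel)"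
    using int I(1) log_majorant_integral(1)[of N] pw by (intro integral_mono) auto
  also have "\<dots> = 12 * exp 2 * pi * real N"
    using I log_majorant_integral[of N] by simp
  finally show "(\<integral>x. planar_weight N x * sqrt (slope x) / space_sq x \<partial>lborel) \<le> 12 * exp 2 * pi * real N" .
qed

end

section \<open>The stability estimate\<close>

context entire_solution begin

text \<open>
  This cutoff depends on the distance in space. Along steep parts of the graph its planar
  derivative is large, but in the direction in which the elliptic form is small.
\<close>

definition space_cutoff where "space_cutoff N x = max 0 (1 - ln (space_sq x) / real N)"
definition energy_test where "energy_test N x = arctan (p x) * ramp_sq (ln (space_sq x) / real N)"

lemma space_cutoff_bounds: "0 \<le> space_cutoff N x" "ramp_sq (ln (space_sq x) / real N) = (space_cutoff N x)\<^sup>2"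
  by (auto simp: space_cutoff_def ramp_sq_def)

lemma space_cutoff_support:
  assumes "N > 0" "norm x > exp (real N)" shows "space_cutoff N x = 0"
proof -
  have "2 * real N \<le> ln (space_sq x)" using assms
    by (intro log_cutoff_vanishes[of x]) (auto simp: space_sq_def planar_sq_def)
  then have "real N \<le> ln (space_sq x)" by simp
  then show ?thesis using assms by (simp add: space_cutoff_def)
qed

lemma cont_space_cutoff: "N > 0 \<Longrightarrow> continuous_on UNIV (space_cutoff N)"
proof -
  assume N: "N > 0"
  have "space_sq x \<noteq> 0" for x using space_sq_ge(1)[of x] by auto
  then show ?thesis unfolding space_cutoff_def[abs_def] using N
    by (intro continuous_intros cont_aux) auto
qed

text \<open>
  Half the gradient of \<open>space_sq\<close>.
\<close>

definition w1 where "w1 x = x $ 1 + f x * p x"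
definition w2 where "w2 x = x $ 2 + f x * q x"

lemma grad_energy_test:
  assumes N: "N > 0"
  shows "has_grad (energy_test N)
    ((space_cutoff N x)\<^sup>2 * p1 x / (1 + (p x)\<^sup>2) - 4 / real N * arctan (p x) * space_cutoff N x / space_sq x * w1 x)
    ((space_cutoff N x)\<^sup>2 * p2 x / (1 + (p x)\<^sup>2) - 4 / real N * arctan (p x) * space_cutoff N x / space_sq x * w2 x) x"
proof -
  have d: "space_sq x > 0" using space_sq_ge(1)[of x] by simp
  have "((\<lambda>s. ln s / real N) has_real_derivative 1 / space_sq x / real N) (at (space_sq x))"
    using d N by (auto intro!: derivative_eq_intros)
  note grad_cutoff = has_grad_chain[OF ramp_sq_has_derivative has_grad_chain[OF this grad_space_sq]]
  note at = has_grad_chain[OF DERIV_arctan grad_p]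
  have eq: "a * (- 2 * m * (1 / d / n * (2 * w))) + inverse D * P * m\<^sup>2
      = m\<^sup>2 * P / D - 4 / n * a * m / d * w" for a m d n w D P :: real
    by (simp add: divide_inverse)
  show ?thesis unfolding energy_test_def[abs_def]
    by (rule has_grad_eq[OF has_grad_mult[OF at grad_cutoff]])
       (unfold space_cutoff_bounds(2) space_cutoff_def[symmetric] w1_def[symmetric] w2_def[symmetric], rule eq, rule eq)
qed

definition weighted_energy where "weighted_energy N x = (space_cutoff N x)\<^sup>2 * hessian_energy x / (1 + (p x)\<^sup>2)"

lemma weighted_energy_nonneg: "0 \<le> weighted_energy N x"
  unfolding weighted_energy_def hessian_energy_def by (intro divide_nonneg_pos mult_nonneg_nonneg elliptic_form_nonneg[OF k]) (auto simp: add_pos_nonneg)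

lemma cont_weighted_energy: "N > 0 \<Longrightarrow> continuous_on UNIV (weighted_energy N)"
proof -
  assume N: "N > 0"
  have "1 + (p x)\<^sup>2 \<noteq> 0" for x using zero_le_power2[of "p x"] by linarith
  then show ?thesis unfolding weighted_energy_def[abs_def]
    by (intro continuous_intros cont_AB cont_space_cutoff[OF N] cont1) auto
qed

lemma weighted_energy_integrable: "N > 0 \<Longrightarrow> integrable lborel (weighted_energy N)"
  by (rule integrable_compact_support[OF cont_weighted_energy, of _ "exp (real N)"]) (auto simp: weighted_energy_def space_cutoff_support)

text \<open>
  The cross term from testing with \<open>arctan p\<close> times the squared cutoff is split by
  \<open>elliptic_form_young\<close>. The factor \<open>1 + p\<^sup>2 \<le> t\<close> lost in the second part
  is paid for by \<open>elliptic_form_position_bound\<close>, leaving the area element over the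
  squared distance. Where the cutoff in space is positive the planar weight is at least
  \<open>1 / 4\<close>, since its logarithmic scale is twice as long.
\<close>

lemma pointwise_caccioppoli:
  fixes x :: "real ^ 2"
  assumes N: "N > 0"
  defines "M \<equiv> elliptic_form k (p x) (q x) (p1 x) (p2 x) (w1 x) (w2 x)"
  shows "8 / real N * arctan (p x) * space_cutoff N x / space_sq x * M
    \<le> weighted_energy N x + 1024 / (real N)\<^sup>2 * (planar_weight N x * sqrt (slope x) / space_sq x)"
proof (cases "space_cutoff N x = 0")
  case True
  have "planar_weight N x \<ge> 0" by (simp add: planar_cutoff_bounds(3))
  then show ?thesis using True weighted_energy_nonneg[of N x] space_sq_ge(1)[of x] slope_ge[of x] by simp
next
  case False
  define D where "D = 1 + (p x)\<^sup>2"
  define W where "W = elliptic_form k (p x) (q x) (w1 x) (w2 x) (w1 x) (w2 x)"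
  define \<rho> where "\<rho> = space_sq x"
  define a where "a = arctan (p x)"
  have D: "D > 0" "D \<le> slope x" by (auto simp: D_def slope_def add_pos_nonneg)
  have \<rho>: "\<rho> > 0" using space_sq_ge(1)[of x] by (simp add: \<rho>_def)
  have W0: "0 \<le> W" unfolding W_def by (rule elliptic_form_nonneg[OF k])
  have "2 * space_cutoff N x * (4 * a / (real N * \<rho>)) * M
      \<le> (space_cutoff N x)\<^sup>2 * hessian_energy x / D + (4 * a / (real N * \<rho>))\<^sup>2 * D * W"
    unfolding M_def W_def hessian_energy_def by (rule elliptic_form_young[OF k D(1)])
  also have "(space_cutoff N x)\<^sup>2 * hessian_energy x / D = weighted_energy N x" by (simp add: weighted_energy_def D_def)
  finally have y: "8 / real N * a * space_cutoff N x / \<rho> * M \<le> weighted_energy N x + (4 * a / (real N * \<rho>))\<^sup>2 * D * W"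
    by (simp add: algebra_simps)
  have "D * W \<le> slope x * W" using D W0 by (intro mult_right_mono)
  also have "\<dots> \<le> 4 * sqrt (slope x) * ((x $ 1)\<^sup>2 + (x $ 2)\<^sup>2 + (f x)\<^sup>2)"
    unfolding W_def slope_def w1_def w2_def by (rule elliptic_form_position_bound[OF k])
  also have "\<dots> \<le> 4 * sqrt (slope x) * \<rho>"
    using slope_ge[of x] by (intro mult_left_mono) (auto simp: \<rho>_def space_sq_def planar_sq_def)
  finally have DW: "D * W \<le> 4 * sqrt (slope x) * \<rho>" .
  have a2: "a\<^sup>2 \<le> 4" using abs_arctan_le_2[of "p x"] power_mono[of "\<bar>a\<bar>" 2 2] by (simp add: a_def)
  have weight: "1 \<le> 4 * planar_weight N x"
  proof -
    have "ln (space_sq x) < real N" using False N by (auto simp: space_cutoff_def max_def divide_less_eq split: if_splits)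
    moreover have "ln (planar_sq x) \<le> ln (space_sq x)" using space_sq_ge(2)[of x] planar_sq_ge[of x] by (intro ln_mono) auto
    ultimately have "ln (planar_sq x) / (2 * real N) \<le> 1 / 2" using N by (simp add: divide_le_eq)
    then have "1 / 2 \<le> planar_cutoff N x" unfolding planar_cutoff_def by simp
    then have "(1 / 2)\<^sup>2 \<le> (planar_cutoff N x)\<^sup>2" by (intro power_mono) auto
    then show ?thesis by (simp add: planar_cutoff_bounds(3) power_divide)
  qed
  have "(4 * a / (real N * \<rho>))\<^sup>2 * D * W = 16 * a\<^sup>2 / (real N * \<rho>)\<^sup>2 * (D * W)"
    by (simp add: power_divide power_mult_distrib)
  also have "\<dots> \<le> 16 * 4 / (real N * \<rho>)\<^sup>2 * (4 * sqrt (slope x) * \<rho>)"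
  proof (rule mult_mono[OF _ DW])
    show "16 * a\<^sup>2 / (real N * \<rho>)\<^sup>2 \<le> 16 * 4 / (real N * \<rho>)\<^sup>2"
      using a2 by (intro divide_right_mono) auto
    show "0 \<le> D * W" using D W0 by simp
  qed simp
  also have "\<dots> = 256 / (real N)\<^sup>2 * (1 * sqrt (slope x) / \<rho>)"
    using \<rho> N by (simp add: power_mult_distrib power2_eq_square)
  also have "\<dots> \<le> 256 / (real N)\<^sup>2 * (4 * planar_weight N x * sqrt (slope x) / \<rho>)"
    using weight \<rho> slope_ge[of x] by (intro mult_left_mono divide_right_mono mult_right_mono) auto
  also have "\<dots> = 1024 / (real N)\<^sup>2 * (planar_weight N x * sqrt (slope x) / \<rho>)" by simp
  finally show ?thesis using y by (simp add: a_def \<rho>_def)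
qed

text \<open>
  Testing the differentiated equation gives an integral \<open>J\<close> equal to zero, the weighted energy
  minus the cross term. After the pointwise estimate the remaining error is \<open>1 / N\<^sup>2\<close> times the
  integral in \<open>area_growth\<close>, which is of order \<open>N\<close>.
\<close>

lemma stability_estimate:
  assumes N: "N > 0"
  shows "(\<integral>x. weighted_energy N x \<partial>lborel) \<le> 1024 * 12 * exp 2 * pi / real N"
proof -
  define e1 where "e1 = (\<lambda>x. (space_cutoff N x)\<^sup>2 * p1 x / (1 + (p x)\<^sup>2) - 4 / real N * arctan (p x) * space_cutoff N x / space_sq x * w1 x)"
  define e2 where "e2 = (\<lambda>x. (space_cutoff N x)\<^sup>2 * p2 x / (1 + (p x)\<^sup>2) - 4 / real N * arctan (p x) * space_cutoff N x / space_sq x * w2 x)"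
  have g: "has_grad (energy_test N) (e1 x) (e2 x) x" for x using grad_energy_test[OF N] by (simp add: e1_def e2_def)
  have nz: "1 + (p x)\<^sup>2 \<noteq> 0" "space_sq x \<noteq> 0" for x
    using zero_le_power2[of "p x"] space_sq_ge(1)[of x] by linarith+
  have cw: "continuous_on UNIV w1" "continuous_on UNIV w2"
    unfolding w1_def[abs_def] w2_def[abs_def] by (intro continuous_intros cont1)+
  have ce: "continuous_on UNIV e1" "continuous_on UNIV e2"
    unfolding e1_def e2_def by (intro continuous_intros cont_space_cutoff[OF N] cont_aux cont1 cont2 cw; use nz N in simp)+
  have supp: "energy_test N x = 0" if "norm x > exp (real N)" for x
    using space_cutoff_support[OF N that] by (simp add: energy_test_def space_cutoff_bounds(2))
  define J where "J = (\<lambda>x. B1 x * e2 x - B2 x * e1 x)"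
  have J: "integrable lborel J" "(\<integral>x. J x \<partial>lborel) = 0"
    using integral_jacobian_zero[OF grad_B g cont_AB(3,4) ce supp] by (simp_all add: J_def)
  let ?M = "\<lambda>x. elliptic_form k (p x) (q x) (p1 x) (p2 x) (w1 x) (w2 x)"
  let ?R = "\<lambda>x. planar_weight N x * sqrt (slope x) / space_sq x"
  have J_eq: "J x = weighted_energy N x - 4 / real N * arctan (p x) * space_cutoff N x / space_sq x * ?M x" for x
  proof -
    \<comment> \<open>This replaces the first component of the differentiated field by one of the rotated gradient of K q.\<close>
    have A: "A1 x = - B2 x" using divergence_free[of x] by linarith
    have hessian_energy: "hessian_energy x = A1 x * p1 x + B1 x * p2 x"
      by (simp add: hessian_energy_def A1_def B1_def elliptic_form_def algebra_simps)
    have M: "?M x = A1 x * w1 x + B1 x * w2 x"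
      by (simp add: A1_def B1_def elliptic_form_def algebra_simps)
    have "b * (t * P2 / D - c * v2) - b2 * (t * P1 / D - c * v1)
      = t * (- b2 * P1 + b * P2) / D - c * (- b2 * v1 + b * v2)" for b b2 t P1 P2 D c v1 v2 :: real
      by (simp add: ring_distribs add_divide_distrib diff_divide_distrib mult_ac)
    then show ?thesis unfolding J_def e1_def e2_def weighted_energy_def hessian_energy M A .
  qed
  have pw: "weighted_energy N x \<le> 2 * J x + 1024 / (real N)\<^sup>2 * ?R x" for x
  proof -
    have "8 / real N * arctan (p x) * space_cutoff N x / space_sq x * ?M x = 2 * (4 / real N * arctan (p x) * space_cutoff N x / space_sq x * ?M x)"
      by simp
    then show ?thesis using pointwise_caccioppoli[OF N, of x] unfolding J_eq right_diff_distrib by linarith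
  qed
  have "(\<integral>x. weighted_energy N x \<partial>lborel) \<le> (\<integral>x. 2 * J x + 1024 / (real N)\<^sup>2 * ?R x \<partial>lborel)"
  proof (rule integral_mono[OF weighted_energy_integrable[OF N] _ pw])
    show "integrable lborel (\<lambda>x. 2 * J x + 1024 / (real N)\<^sup>2 * ?R x)"
      by (intro Bochner_Integration.integrable_add integrable_mult_right J(1) area_growth(1)[OF N])
  qed
  also have "\<dots> = 2 * (\<integral>x. J x \<partial>lborel) + 1024 / (real N)\<^sup>2 * (\<integral>x. ?R x \<partial>lborel)"
    by (subst Bochner_Integration.integral_add)
       (intro integrable_mult_right J(1) area_growth(1)[OF N] | simp only: integral_mult_right_zero)+
  also have "\<dots> \<le> 1024 / (real N)\<^sup>2 * (12 * exp 2 * pi * real N)"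
    unfolding J(2) using area_growth(2)[OF N] by (simp only: mult_zero_right add_0) (intro mult_left_mono, auto)
  also have "\<dots> = 1024 * 12 * exp 2 * pi / real N" using N by (simp add: power2_eq_square)
  finally show ?thesis .
qed

lemma space_cutoff_mono: "0 < n \<Longrightarrow> n \<le> N \<Longrightarrow> space_cutoff n x \<le> space_cutoff N x"
proof -
  assume n: "0 < n" "n \<le> N"
  have "ln (space_sq x) \<ge> 0" using space_sq_ge(1)[of x] by simp
  then have "ln (space_sq x) / real N \<le> ln (space_sq x) / real n" using n by (intro divide_left_mono) auto
  then show ?thesis by (auto simp: space_cutoff_def)
qed

text \<open>
  The cutoffs increase with \<open>N\<close>, so the energy at a fixed scale is below that at every larger one, and
  those tend to zero.
\<close>

lemma weighted_energy_eq_0: "n > 0 \<Longrightarrow> weighted_energy n x = 0"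
proof -
  assume n: "n > 0"
  have le: "(\<integral>x. weighted_energy n x \<partial>lborel) \<le> 1024 * 12 * exp 2 * pi / real N" if N: "n \<le> N" for N
  proof -
    have "weighted_energy n x \<le> weighted_energy N x" for x
      unfolding weighted_energy_def using space_cutoff_mono[OF n N, of x] space_cutoff_bounds(1)
      by (intro divide_right_mono mult_right_mono power_mono) (auto simp: hessian_energy_def elliptic_form_nonneg[OF k])
    then have "(\<integral>x. weighted_energy n x \<partial>lborel) \<le> (\<integral>x. weighted_energy N x \<partial>lborel)"
      using weighted_energy_integrable n N by (intro integral_mono) auto
    also have "\<dots> \<le> 1024 * 12 * exp 2 * pi / real N" using n N by (intro stability_estimate) auto
    finally show ?thesis .
  qed
  have "(\<lambda>N. 1024 * 12 * exp 2 * pi / real N) \<longlonglongrightarrow> 0" by (rule lim_const_over_n)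
  then have "(\<integral>x. weighted_energy n x \<partial>lborel) \<le> 0"
    by (rule LIMSEQ_le_const) (use le in blast)
  moreover have "(\<integral>x. weighted_energy n x \<partial>lborel) \<ge> 0" using weighted_energy_nonneg by simp
  ultimately show ?thesis
    using continuous_nonneg_integral_zero[OF cont_weighted_energy[OF n] weighted_energy_nonneg weighted_energy_integrable[OF n]] by simp
qed

text \<open>
  The vanishing energy kills \<open>grad p\<close>; the equation then reads \<open>(kappa + mu q\<^sup>2) q2 = 0\<close>
  with a positive coefficient.
\<close>

lemma hessian_zero: "p1 x = 0" "p2 x = 0" "q2 x = 0"
proof -
  obtain n where n: "ln (space_sq x) < real n" using reals_Archimedean2 by blast
  have "ln (space_sq x) \<ge> 0" using space_sq_ge(1)[of x] by simp
  then have "n > 0" using n by (auto intro: gr0I)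
  then have "space_cutoff n x \<noteq> 0" using n by (simp add: space_cutoff_def max_def)
  moreover have "1 + (p x)\<^sup>2 \<noteq> 0" using zero_le_power2[of "p x"] by linarith
  ultimately have "hessian_energy x = 0" using weighted_energy_eq_0[OF \<open>n > 0\<close>, of x] by (simp add: weighted_energy_def)
  then show p: "p1 x = 0" "p2 x = 0" using elliptic_form_definite[OF k, of "p x" "q x" "p1 x" "p2 x"] unfolding hessian_energy_def by blast+
  have "elliptic_form k (p x) (q x) 0 1 0 1 * q2 x = 0"
  proof -
    have "elliptic_form k (p x) (q x) 0 1 0 1 * q2 x = kappa k (1 + (p x)\<^sup>2 + (q x)\<^sup>2) * (p1 x + q2 x)
      + mu k (1 + (p x)\<^sup>2 + (q x)\<^sup>2) * ((p x)\<^sup>2 * p1 x + 2 * p x * q x * p2 x + (q x)\<^sup>2 * q2 x)"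
      unfolding p by (simp add: elliptic_form_def power2_eq_square algebra_simps)
    then show ?thesis using equation[of x] by (simp only:)
  qed
  moreover have "elliptic_form k (p x) (q x) 0 1 0 1 \<noteq> 0" using elliptic_form_definite[OF k, of "p x" "q x" 0 1] by auto
  ultimately show "q2 x = 0" by simp
qed

theorem affine_solution: "\<exists>a c d. \<forall>x. f x = a + c * x $ 1 + d * x $ 2"
proof -
  have const: "\<exists>c. \<forall>x. g x = c" if "\<And>x. has_grad g 0 0 x" for g
  proof -
    have "(g has_derivative (\<lambda>h. 0)) (at x within UNIV)" for x using that by (simp add: has_grad_def)
    then show ?thesis using has_derivative_zero_constant[of UNIV g] by auto
  qed
  obtain c d where c: "\<And>x. p x = c" and d: "\<And>x. q x = d"
    using const[of p] const[of q] grad_p grad_q hessian_zero by metis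
  have "has_grad (\<lambda>x. f x + (- c * x $ 1 + - d * x $ 2)) 0 0 x" for x
    by (rule has_grad_eq[OF has_grad_add[OF grad_f has_grad_add[OF has_grad_mult[OF has_grad_const has_grad_coord(1)]
        has_grad_mult[OF has_grad_const has_grad_coord(2)]]]]) (simp_all add: c d)
  then obtain a where "\<And>x. f x + (- c * x $ 1 + - d * x $ 2) = a" using const by blast
  then have "f x = a + c * x $ 1 + d * x $ 2" for x by (simp add: algebra_simps)
  then show ?thesis by blast
qed

end

section \<open>The Bernstein theorem\<close>

lemma smooth_derivative:
  assumes "smooth g"
  shows "smooth (\<lambda>x. frechet_derivative g (at x) v)" "g differentiable (at x)" "continuous_on UNIV g"
proof -
  have h: "C_k (Suc n) g" for n using assms by (simp add: smooth_def del: C_k.simps)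
  then show "smooth (\<lambda>x. frechet_derivative g (at x) v)" "g differentiable (at x)" by (simp_all add: smooth_def)
  have "C_k 0 g" using assms unfolding smooth_def by blast
  then show "continuous_on UNIV g" by simp
qed

lemma smooth_pdx:
  fixes g :: "real ^ 2 \<Rightarrow> real"
  assumes "smooth g"
  shows "smooth (pdx i g)" "has_grad g (pdx 1 g x) (pdx 2 g x) x"
proof -
  have D: "(g has_derivative frechet_derivative g (at x)) (at x)" for x
    using smooth_derivative(2)[OF assms] frechet_derivative_works by blast
  have pd: "pd v g x = frechet_derivative g (at x) v" for v x
    by (rule pd_eq_if, rule has_derivative_along_line) (simp add: D)
  show "smooth (pdx i g)" unfolding pd using smooth_derivative(1)[OF assms] .
  have "frechet_derivative g (at x) h = pdx 1 g x * h $ 1 + pdx 2 g x * h $ 2" for h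
  proof -
    have "h = h $ 1 *\<^sub>R axis 1 1 + h $ 2 *\<^sub>R axis 2 1" by (simp add: vec_eq_iff forall_2 axis_def)
    then have "frechet_derivative g (at x) h = frechet_derivative g (at x) (h $ 1 *\<^sub>R axis 1 1 + h $ 2 *\<^sub>R axis 2 1)"
      by (rule arg_cong)
    also have "\<dots> = h $ 1 *\<^sub>R frechet_derivative g (at x) (axis 1 1) + h $ 2 *\<^sub>R frechet_derivative g (at x) (axis 2 1)"
      unfolding linear_add[OF has_derivative_linear[OF D]] linear_cmul[OF has_derivative_linear[OF D]] ..
    finally show ?thesis by (simp add: pd mult.commute)
  qed
  then show "has_grad g (pdx 1 g x) (pdx 2 g x) x" unfolding has_grad_def using D[of x] by (metis (no_types, lifting) ext)
qed

lemma is_plane_affine_graph: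
  assumes f: "\<And>x. f x = a + c * x $ 1 + d * x $ 2"
  shows "is_plane (range (graph_map f))"
proof -
  define L where "L = (\<lambda>x :: real ^ 2. vector [x $ 1, x $ 2, c * x $ 1 + d * x $ 2] :: real ^ 3)"
  have L: "linear L" by (rule linearI) (simp_all add: L_def vec_eq_iff forall_3 algebra_simps)
  have inj: "inj L"
    unfolding linear_injective_0[OF L] by (simp add: L_def vec_eq_iff forall_3 forall_2)
  have "graph_map f x = vector [0, 0, a] + L x" for x
    by (simp add: graph_map_def L_def f vec_eq_iff forall_3)
  then have r: "range (graph_map f) = (+) (vector [0, 0, a]) ` range L" by (simp add: image_image)
  have s: "subspace (range L)" by (rule linear_subspace_image[OF L subspace_UNIV])
  have "dim (range L) = dim (UNIV :: (real ^ 2) set)"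
    by (rule dim_image_eq[OF L]) (use inj in auto)
  then have "aff_dim (range L) = 2" unfolding aff_dim_subspace[OF s] by simp
  then show ?thesis
    unfolding is_plane_def r using affine_translation[of "range L"] subspace_imp_affine[OF s]
    by (simp add: aff_dim_translation_eq)
qed

theorem theorem4p4:
  fixes b :: real and f :: "real ^ 2 \<Rightarrow> real"
  assumes "0 \<le> b" and "b < 1 / 2"
    and "smooth f"
    and "minimal b (graph_map f)"
  shows "is_plane (range (graph_map f))"
proof -
  let ?p = "pdx 1 f" and ?q = "pdx 2 f"
  note p = smooth_pdx(1)[OF assms(3), of 1] and q = smooth_pdx(1)[OF assms(3), of 2]
  note cont = smooth_derivative(3)[OF smooth_pdx(1)]
  have sym: "pdx 2 ?p x = pdx 1 ?q x" for x
    by (rule mixed_partials_commute[OF smooth_pdx(2)[OF assms(3)] smooth_pdx(2)[OF p] smooth_pdx(2)[OF q]])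
       (intro cont p q)+
  interpret entire_solution "slant b" f ?p ?q "pdx 1 ?p" "pdx 2 ?p" "pdx 2 ?q"
  proof
    show "0 \<le> slant b" "slant b < 1 / 9" using slant_bounds[OF assms(1,2)] by auto
    show "has_grad f (?p x) (?q x) x" for x by (rule smooth_pdx(2)[OF assms(3)])
    show "has_grad ?p (pdx 1 ?p x) (pdx 2 ?p x) x" for x by (rule smooth_pdx(2)[OF p])
    show "has_grad ?q (pdx 2 ?p x) (pdx 2 ?q x) x" for x unfolding sym by (rule smooth_pdx(2)[OF q])
    show "continuous_on UNIV (pdx 1 ?p)" "continuous_on UNIV (pdx 2 ?p)" "continuous_on UNIV (pdx 2 ?q)"
      by (intro cont p q)+
    show "kappa (slant b) (1 + (?p x)\<^sup>2 + (?q x)\<^sup>2) * (pdx 1 ?p x + pdx 2 ?q x)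
      + mu (slant b) (1 + (?p x)\<^sup>2 + (?q x)\<^sup>2)
        * ((?p x)\<^sup>2 * pdx 1 ?p x + 2 * ?p x * ?q x * pdx 2 ?p x + (?q x)\<^sup>2 * pdx 2 ?q x) = 0" for x
      using minimal_graph_equation[OF assms(1,2,4), of x] unfolding sym
      by (simp add: power2_eq_square algebra_simps)
  qed
  show ?thesis using affine_solution is_plane_affine_graph by blast
qed

end
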